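(* For every integer $d\ge 2$, the $d$-dimensional product copula $\Pi$ and its order transform $\Pi_T$ satisfy $$[\Pi,\Pi]=\frac{1}{2^d}<\frac{1}{d+1}=[\Pi_T,\Pi_T]$$ and hence $$\kappa[\Pi]=0<\frac{2^d-(d+1)}{(2^{d-1}-1)(d+1)}=\kappa[\Pi_T].$$ In particular, $\lim_{d\to\infty}\kappa[\Pi_T]=0$ (where for each $d$, $\Pi_T$ is the order transform of the $d$-dimensional product copula).
   Context: Notation: $\overline{\mathbb R}=[-\infty,\infty]$. The product copula is $\Pi(\mathbf u)=\prod_{k=1}^d u_k$ on $[0,1]^d$. For a copula $C$ on $[0,1]^d$, $Q^C$ is the unique Borel probability measure on $[0,1]^d$ with $Q^C[[\mathbf 0,\mathbf u]]=C(\mathbf u)$ for all $\mathbf u\in[0,1]^d$. Kendall's tau: for $d$-dimensional copulas $C,D$ put $[C,D]:=\int_{[0,1]^d}C(\mathbf u)\,dQ^D(\mathbf u)$ and $\kappa[C]:=\dfrac{2^d[C,C]-1}{2^{d-1}-1}$. Order transform: $T:\overline{\mathbb R}^d\to\overline{\mathbb R}^d$ is $(T(\mathbf x))_k:=\min_{J\subseteq\{1,\dots,d\},|J|=k}\max_{l\in J}x_l$, i.e. $T(\mathbf x)$ is the nondecreasing rearrangement of $\mathbf x$. For a copula $C$, let $H^C:\overline{\mathbb R}^d\to[0,1]$ be the distribution function extending $C$, i.e. $H^C(\mathbf x)=C(h(x_1),\dots,h(x_d))$ with $h(x)=\max\{0,\min\{x,1\}\}$, and let $Q^{H^C}$ be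 the corresponding probability measure. Let $H^C_T$ be the distribution function of the image measure $(Q^{H^C})_T=Q^{H^C}\circ T^{-1}$. Its univariate marginal distribution functions $(H^C_T)_1,\dots,(H^C_T)_d$ are continuous, so there is a unique copula $C_T$, called the order transform of $C$, with $H^C_T(\mathbf x)=C_T\big((H^C_T)_1(x_1),\dots,(H^C_T)_d(x_d)\big)$ for all $\mathbf x\in\overline{\mathbb R}^d$. *)

theory Defs
  imports "HOL-Probability.Probability"
begin

text \<open>
  Since the dimension \<open>d\<close> varies (a limit \<open>d \<rightarrow> \<infinity>\<close> is taken), vectors are extensional functions
  on the index set \<open>{1..d}\<close>, and functions on the unit cube are extensional on the cube, so that
  equality of copulas is equality as functions on the cube.
\<close>

definition unit_cube :: "nat \<Rightarrow> (nat \<Rightarrow> real) set" where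
  "unit_cube d = ({1..d} \<rightarrow>\<^sub>E {0..1})"

text \<open>The alternating sum below is the volume assigned by \<open>C\<close> to the box \<open>[a, b]\<close>.\<close>

definition is_copula :: "nat \<Rightarrow> ((nat \<Rightarrow> real) \<Rightarrow> real) \<Rightarrow> bool" where
  "is_copula d C \<longleftrightarrow>
     C \<in> unit_cube d \<rightarrow>\<^sub>E {0..1} \<and>
     (\<forall>u\<in>unit_cube d. (\<exists>k\<in>{1..d}. u k = 0) \<longrightarrow> C u = 0) \<and>
     (\<forall>k\<in>{1..d}. \<forall>t\<in>{0..1}. C (\<lambda>j\<in>{1..d}. if j = k then t else 1) = t) \<and>
     (\<forall>a\<in>unit_cube d. \<forall>b\<in>unit_cube d. (\<forall>k\<in>{1..d}. a k \<le> b k) \<longrightarrow>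
        0 \<le> (\<Sum>J\<in>Pow {1..d}. (- 1) ^ card J * C (\<lambda>k\<in>{1..d}. if k \<in> J then a k else b k)))"

definition product_copula :: "nat \<Rightarrow> (nat \<Rightarrow> real) \<Rightarrow> real" where
  "product_copula d = (\<lambda>u\<in>unit_cube d. \<Prod>k=1..d. u k)"

definition copula_measure :: "nat \<Rightarrow> ((nat \<Rightarrow> real) \<Rightarrow> real) \<Rightarrow> (nat \<Rightarrow> real) measure" where
  "copula_measure d C = (THE Q. prob_space Q \<and>
     sets Q = sets (Pi\<^sub>M {1..d} (\<lambda>_. restrict_space borel {0..1})) \<and>
     (\<forall>u\<in>unit_cube d. measure Q (\<Pi>\<^sub>E k\<in>{1..d}. {0..u k}) = C u))"

definition copula_bracket ::
  "nat \<Rightarrow> ((nat \<Rightarrow> real) \<Rightarrow> real) \<Rightarrow> ((nat \<Rightarrow> real) \<Rightarrow> real) \<Rightarrow> real" where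
  "copula_bracket d C D = (\<integral>u. C u \<partial>copula_measure d D)"

definition kendall_tau :: "nat \<Rightarrow> ((nat \<Rightarrow> real) \<Rightarrow> real) \<Rightarrow> real" where
  "kendall_tau d C = (2 ^ d * copula_bracket d C C - 1) / (2 ^ (d - 1) - 1)"

definition order_map :: "nat \<Rightarrow> (nat \<Rightarrow> ereal) \<Rightarrow> nat \<Rightarrow> ereal" where
  "order_map d x = (\<lambda>k\<in>{1..d}. Min {Max (x ` J) | J. J \<subseteq> {1..d} \<and> card J = k})"

abbreviation ereal_space :: "nat \<Rightarrow> (nat \<Rightarrow> ereal) measure" where
  "ereal_space d \<equiv> Pi\<^sub>M {1..d} (\<lambda>_. borel)"

definition copula_df :: "nat \<Rightarrow> ((nat \<Rightarrow> real) \<Rightarrow> real) \<Rightarrow> (nat \<Rightarrow> ereal) \<Rightarrow> real" where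
  "copula_df d C x = C (\<lambda>k\<in>{1..d}. real_of_ereal (max 0 (min (x k) 1)))"

definition df_measure :: "nat \<Rightarrow> ((nat \<Rightarrow> ereal) \<Rightarrow> real) \<Rightarrow> (nat \<Rightarrow> ereal) measure" where
  "df_measure d H = (THE Q. prob_space Q \<and> sets Q = sets (ereal_space d) \<and>
     (\<forall>x\<in>space (ereal_space d). measure Q (\<Pi>\<^sub>E k\<in>{1..d}. {..x k}) = H x))"

definition order_df :: "nat \<Rightarrow> ((nat \<Rightarrow> real) \<Rightarrow> real) \<Rightarrow> (nat \<Rightarrow> ereal) \<Rightarrow> real" where
  "order_df d C x =
     measure (distr (df_measure d (copula_df d C)) (ereal_space d) (order_map d))
       (\<Pi>\<^sub>E k\<in>{1..d}. {..x k})"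

definition marginal_df :: "nat \<Rightarrow> ((nat \<Rightarrow> ereal) \<Rightarrow> real) \<Rightarrow> nat \<Rightarrow> ereal \<Rightarrow> real" where
  "marginal_df d H k t = H (\<lambda>j\<in>{1..d}. if j = k then t else \<infinity>)"

definition order_transform :: "nat \<Rightarrow> ((nat \<Rightarrow> real) \<Rightarrow> real) \<Rightarrow> (nat \<Rightarrow> real) \<Rightarrow> real" where
  "order_transform d C = (THE D. is_copula d D \<and>
     (\<forall>x\<in>space (ereal_space d).
        order_df d C x = D (\<lambda>k\<in>{1..d}. marginal_df d (order_df d C) k (x k))))"

end

theory Submission
  imports Defs "HOL-Real_Asymp.Real_Asymp"
begin

text \<open>
  If \<open>C\<close> is the copula of a random vector \<open>X\<close> with continuous margins, then by Sklar's theorem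
  \<open>[C, C]\<close> is the probability that an independent copy \<open>X'\<close> satisfies \<open>X'\<^sub>k \<le> X\<^sub>k\<close> for all \<open>k\<close>. If the
  components of \<open>X\<close> are \<open>d\<close> independent draws from one distribution, this probability is \<open>1 / 2 ^ d\<close>.
  If they are the order statistics of such draws, then \<open>X' \<le> X\<close> means that every initial segment
  of the line contains at least as many points of \<open>X'\<close> as of \<open>X\<close>. For \<open>a\<close> points of the first and
  \<open>b\<close> points of the second kind, conditioning on the largest of all points gives the recursion of
  the ballot problem, with solution \<open>(a - b + 1) / (a + 1)\<close>; put \<open>a = b = d\<close>.
\<close>

section \<open>Independent draws from an atomless distribution\<close>

lemma borel_measurable_pred_le [measurable (raw)]:
  fixes f g :: "'a \<Rightarrow> 'b::{second_countable_topology, linorder_topology}"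
  shows "f \<in> borel_measurable M \<Longrightarrow> g \<in> borel_measurable M \<Longrightarrow> Measurable.pred M (\<lambda>w. f w \<le> g w)"
  unfolding Measurable.pred_def by (rule borel_measurable_le)

lemma (in product_sigma_finite) emeasure_PiM_insert_Collect:
  assumes "finite I" "i \<notin> I" and P: "Measurable.pred (PiM (insert i I) M) P"
  shows "emeasure (PiM (insert i I) M) {x\<in>space (PiM (insert i I) M). P x} =
    (\<integral>\<^sup>+w. emeasure (PiM I M) {x\<in>space (PiM I M). P (x(i := w))} \<partial>M i)"
proof -
  let ?S = "\<lambda>J. space (PiM J M)"
  have "emeasure (PiM (insert i I) M) {x\<in>?S (insert i I). P x} =
      (\<integral>\<^sup>+x. indicator {x\<in>?S (insert i I). P x} x \<partial>PiM (insert i I) M)"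
    using P by simp
  also have "\<dots> = (\<integral>\<^sup>+w. (\<integral>\<^sup>+x. indicator {x\<in>?S (insert i I). P x} (x(i := w)) \<partial>PiM I M) \<partial>M i)"
    using assms by (intro product_nn_integral_insert_rev) auto
  also have "\<dots> = (\<integral>\<^sup>+w. emeasure (PiM I M) {x\<in>?S I. P (x(i := w))} \<partial>M i)"
  proof (rule nn_integral_cong)
    fix w assume w: "w \<in> space (M i)"
    have upd: "(\<lambda>x. x(i := w)) \<in> measurable (PiM I M) (PiM (insert i I) M)"
      using w by (intro measurable_fun_upd) auto
    have "(\<integral>\<^sup>+x. indicator {x\<in>?S (insert i I). P x} (x(i := w)) \<partial>PiM I M) =
        (\<integral>\<^sup>+x. indicator {x\<in>?S I. P (x(i := w))} x \<partial>PiM I M)"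
      using measurable_space[OF upd] by (intro nn_integral_cong) (auto split: split_indicator)
    also have "\<dots> = emeasure (PiM I M) {x\<in>?S I. P (x(i := w))}"
      using measurable_compose[OF upd P] by simp
    finally show "(\<integral>\<^sup>+x. indicator {x\<in>?S (insert i I). P x} (x(i := w)) \<partial>PiM I M) =
        emeasure (PiM I M) {x\<in>?S I. P (x(i := w))}" .
  qed
  finally show ?thesis .
qed

abbreviation iid :: "'i set \<Rightarrow> 'a measure \<Rightarrow> ('i \<Rightarrow> 'a) measure" where
  "iid I M \<equiv> PiM I (\<lambda>_. M)"

locale atomless_prob_space = prob_space M
  for M :: "'a::{linorder_topology, second_countable_topology} measure" +
  assumes sets_eq_borel [simp, measurable_cong]: "sets M = sets borel"
    and emeasure_singleton [simp]: "emeasure M {c} = 0"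
begin

lemma space_eq_UNIV [simp]: "space M = UNIV"
  using sets_eq_imp_space_eq[OF sets_eq_borel] by simp

lemma AE_neq: "AE x in M. x \<noteq> c"
  by (rule AE_I[of _ _ "{c}"]) auto

lemma borel_measurable_iid_component [measurable (raw)]:
  "i \<in> I \<Longrightarrow> (\<lambda>x. x i) \<in> borel_measurable (iid I M)"
  using measurable_component_singleton[of i I "\<lambda>_. M"]
  by (simp add: measurable_cong_sets[OF refl sets_eq_borel])

lemma AE_iid_neq:
  fixes I :: "'i set"
  assumes "finite I" "i \<in> I" "j \<in> I" "i \<noteq> j"
  shows "AE x in iid I M. x i \<noteq> x j"
proof -
  interpret P: product_sigma_finite "\<lambda>_::'i. M"
    by unfold_locales
  let ?K = "I - {i}"
  have K: "insert i ?K = I" "finite ?K" "i \<notin> ?K" "j \<in> ?K"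
    using assms by auto
  have meas: "Measurable.pred (iid I M) (\<lambda>x. x i = x j)"
    using assms(2,3) unfolding eq_iff by measurable
  have null: "emeasure (iid ?K M) {x\<in>space (iid ?K M). w = x j} = 0" for w
  proof -
    have [measurable]: "(\<lambda>x. x j) \<in> borel_measurable (iid ?K M)"
      using K(4) by (rule borel_measurable_iid_component)
    have "AE y in M. w \<noteq> y"
      using AE_neq[of w] by eventually_elim auto
    then have "AE x in iid ?K M. w \<noteq> x j"
      using K(4) by (intro AE_PiM_component[of _ "\<lambda>_. M"] prob_space_axioms)
    then show ?thesis
      by (subst (asm) AE_iff_measurable[OF _ refl]) (simp_all, measurable)
  qed
  have "emeasure (iid I M) {x\<in>space (iid I M). x i = x j} =
      (\<integral>\<^sup>+w. emeasure (iid ?K M) {x\<in>space (iid ?K M). w = x j} \<partial>M)"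
    using P.emeasure_PiM_insert_Collect[OF K(2,3), unfolded K(1), OF meas] assms(4) by simp
  also have "\<dots> = 0"
    by (simp add: null)
  finally show ?thesis
    using meas by (subst AE_iff_measurable[OF _ refl]) auto
qed

end

definition strict_max_at :: "'i set \<Rightarrow> ('i \<Rightarrow> 'a::linorder) \<Rightarrow> 'i \<Rightarrow> bool" where
  "strict_max_at I x i \<longleftrightarrow> (\<forall>j\<in>I - {i}. x j < x i)"

context atomless_prob_space
begin

lemma measurable_strict_max_at [measurable (raw)]:
  "finite I \<Longrightarrow> i \<in> I \<Longrightarrow> Measurable.pred (iid I M) (\<lambda>x. strict_max_at I x i)"
  unfolding strict_max_at_def by measurable

lemma AE_strict_max_at:
  assumes "finite I" "I \<noteq> {}"
  shows "AE x in iid I M. \<exists>i\<in>I. strict_max_at I x i"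
proof -
  have "AE x in iid I M. \<forall>i\<in>I. \<forall>j\<in>I - {i}. x i \<noteq> x j"
    using assms by (intro AE_finite_allI) (auto intro: AE_iid_neq)
  then show ?thesis
  proof eventually_elim
    case (elim x)
    obtain i where i: "i \<in> I" "Max (x ` I) = x i"
      using assms by (rule obtains_MAX)
    have "x j \<le> x i" if "j \<in> I" for j
      using that assms Max_ge[of "x ` I" "x j"] by (simp add: i)
    with elim i(1) have "strict_max_at I x i"
      unfolding strict_max_at_def by (metis DiffD1 order_le_less)
    with i(1) show ?case ..
  qed
qed

lemma emeasure_eq_sum_strict_max_at:
  assumes "finite I" "I \<noteq> {}" and [measurable]: "Measurable.pred (iid I M) P"
  shows "emeasure (iid I M) {x\<in>space (iid I M). P x} =
    (\<Sum>i\<in>I. emeasure (iid I M) {x\<in>space (iid I M). strict_max_at I x i \<and> P x})"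
proof -
  let ?P = "iid I M"
  let ?E = "\<lambda>i. {x\<in>space ?P. strict_max_at I x i \<and> P x}"
  have sets: "?E i \<in> sets ?P" if "i \<in> I" for i
    using that assms(1) by measurable
  have "disjoint_family_on ?E I"
    unfolding disjoint_family_on_def strict_max_at_def by (auto 4 3 dest: less_asym)
  then have "(\<Sum>i\<in>I. emeasure ?P (?E i)) = emeasure ?P (\<Union>i\<in>I. ?E i)"
    using sets assms(1) by (intro sum_emeasure) auto
  also have "\<dots> = emeasure ?P {x\<in>space ?P. P x}"
  proof (rule emeasure_eq_AE)
    show "AE x in ?P. x \<in> (\<Union>i\<in>I. ?E i) \<longleftrightarrow> x \<in> {x\<in>space ?P. P x}"
      using AE_strict_max_at[OF assms(1,2)] by eventually_elim auto
    show "(\<Union>i\<in>I. ?E i) \<in> sets ?P"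
      using sets assms(1) by blast
  qed measurable
  finally show ?thesis ..
qed

lemma emeasure_strict_max_at:
  fixes I :: "'i set"
  assumes "finite I" "i \<in> I" and [measurable]: "D \<in> sets borel" "Measurable.pred (iid I M) P"
    and indep: "\<And>x w. P (x(i := w)) \<longleftrightarrow> P x"
  shows "emeasure (iid I M) {x\<in>space (iid I M). strict_max_at I x i \<and> x i \<in> D \<and> P x} =
    (\<integral>\<^sup>+w\<in>D. emeasure (iid (I - {i}) M)
      {x\<in>space (iid (I - {i}) M). (\<forall>j\<in>I - {i}. x j \<in> {..<w}) \<and> P x} \<partial>M)"
proof -
  interpret P: product_sigma_finite "\<lambda>_::'i. M"
    by unfold_locales
  have remove: "insert i (I - {i}) = I" "finite (I - {i})" "i \<notin> I - {i}"
    using assms by auto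
  have meas: "Measurable.pred (iid I M) (\<lambda>x. strict_max_at I x i \<and> x i \<in> D \<and> P x)"
    using assms(1,2) by measurable
  have "strict_max_at I (x(i := w)) i \<longleftrightarrow> (\<forall>j\<in>I - {i}. x j < w)" for x :: "'i \<Rightarrow> 'a" and w
    by (auto simp: strict_max_at_def)
  then show ?thesis
    using P.emeasure_PiM_insert_Collect[OF remove(2,3), unfolded remove(1), OF meas]
    by (auto simp: indep intro!: nn_integral_cong split: split_indicator)
qed

lemma borel_measurable_emeasure_lessThan [measurable]: "(\<lambda>w. emeasure M {..<w}) \<in> borel_measurable borel"
proof (rule measurable_emeasure)
  show "{x\<in>space (borel \<Otimes>\<^sub>M M). snd x \<in> {..<fst x}} \<in> sets (borel \<Otimes>\<^sub>M M)"
    unfolding lessThan_iff by measurable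
qed simp

lemma nn_integral_emeasure_lessThan_power:
  assumes [measurable]: "D \<in> sets borel" and lower: "\<And>w. w \<in> D \<Longrightarrow> {..<w} \<subseteq> D"
  shows "of_nat (Suc n) * (\<integral>\<^sup>+w\<in>D. emeasure M {..<w} ^ n \<partial>M) = emeasure M D ^ Suc n"
proof -
  interpret P: product_sigma_finite "\<lambda>_::nat. M"
    by unfold_locales
  have box: "{x\<in>space (iid I M). \<forall>i\<in>I. x i \<in> A} = (\<Pi>\<^sub>E i\<in>I. A)" for I :: "nat set" and A
    by (auto simp: space_PiM)
  have "emeasure M D ^ Suc n = emeasure (iid {..n} M) {x\<in>space (iid {..n} M). \<forall>i\<in>{..n}. x i \<in> D}"
    unfolding box by (subst P.emeasure_PiM) auto
  also have "\<dots> = (\<Sum>i\<in>{..n}. emeasure (iid {..n} M)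
      {x\<in>space (iid {..n} M). strict_max_at {..n} x i \<and> (\<forall>i\<in>{..n}. x i \<in> D)})"
    by (intro emeasure_eq_sum_strict_max_at) auto
  also have "\<dots> = (\<Sum>i\<in>{..n}. \<integral>\<^sup>+w\<in>D. emeasure M {..<w} ^ n \<partial>M)"
  proof (intro sum.cong refl)
    fix i assume i: "i \<in> {..n}"
    have "strict_max_at {..n} x i \<and> (\<forall>i\<in>{..n}. x i \<in> D) \<longleftrightarrow> strict_max_at {..n} x i \<and> x i \<in> D"
      for x :: "nat \<Rightarrow> 'a"
      using lower[of "x i"] i by (force simp: strict_max_at_def)
    then have "emeasure (iid {..n} M) {x\<in>space (iid {..n} M). strict_max_at {..n} x i \<and> (\<forall>i\<in>{..n}. x i \<in> D)} =
        (\<integral>\<^sup>+w\<in>D. emeasure (iid ({..n} - {i}) M)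
          {x\<in>space (iid ({..n} - {i}) M). \<forall>j\<in>{..n} - {i}. x j \<in> {..<w}} \<partial>M)"
      using emeasure_strict_max_at[of "{..n}" i D "\<lambda>_. True"] i by simp
    also have "\<dots> = (\<integral>\<^sup>+w\<in>D. emeasure M {..<w} ^ n \<partial>M)"
      using i unfolding box by (subst P.emeasure_PiM) auto
    finally show "emeasure (iid {..n} M) {x\<in>space (iid {..n} M). strict_max_at {..n} x i \<and> (\<forall>i\<in>{..n}. x i \<in> D)} =
        (\<integral>\<^sup>+w\<in>D. emeasure M {..<w} ^ n \<partial>M)" .
  qed
  finally show ?thesis
    by simp
qed

end

section \<open>The ballot problem\<close>

text \<open>
  Whether every initial segment of the line contains at least as many of the points \<open>x i\<close> with
  \<open>i \<in> A\<close> as of those with \<open>i \<in> B\<close> is decided by the segments ending at a point of the second kind.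
\<close>

definition ballot :: "'i set \<Rightarrow> 'i set \<Rightarrow> ('i \<Rightarrow> 'a::linorder) \<Rightarrow> bool" where
  "ballot A B x \<longleftrightarrow> (\<forall>j\<in>B. card {i\<in>B. x i \<le> x j} \<le> card {i\<in>A. x i \<le> x j})"

lemma ballot_fun_upd: "i \<notin> A \<union> B \<Longrightarrow> ballot A B (x(i := y)) = ballot A B x"
  unfolding ballot_def by (intro ball_cong refl arg_cong2[where f="(\<le>)"] arg_cong[where f=card]) auto

lemma not_ballot:
  assumes "finite A" "finite B" "card A < card B"
  shows "\<not> ballot A B x"
proof
  assume ballot: "ballot A B x"
  have "B \<noteq> {}" using assms by auto
  with assms(2) obtain j where j: "j \<in> B" "Max (x ` B) = x j"
    by (rule obtains_MAX)
  then have "{i\<in>B. x i \<le> x j} = B"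
    using assms(2) Max_ge[of "x ` B"] by auto
  with ballot j(1) have "card B \<le> card {i\<in>A. x i \<le> x j}"
    unfolding ballot_def by force
  also have "\<dots> \<le> card A"
    using assms(1) by (intro card_mono) auto
  finally show False using assms(3) by simp
qed

lemma ballot_remove_max:
  assumes "finite A" "finite B" "card B \<le> card A" "i \<in> A \<union> B" and max: "strict_max_at (A \<union> B) x i"
  shows "ballot A B x \<longleftrightarrow> ballot (A - {i}) (B - {i}) x"
proof -
  have le_max: "x j \<le> x i" if "j \<in> A \<union> B" for j
    using max that by (cases "j = i") (auto simp: strict_max_at_def intro: less_imp_le)
  have at_max: "{k\<in>A. x k \<le> x i} = A" "{k\<in>B. x k \<le> x i} = B"
    using le_max by auto
  have below_max: "{k\<in>A. x k \<le> x j} = {k\<in>A - {i}. x k \<le> x j}" "{k\<in>B. x k \<le> x j} = {k\<in>B - {i}. x k \<le> x j}"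
    if "j \<in> B - {i}" for j
    using max[unfolded strict_max_at_def, rule_format, of j] that by auto
  have "ballot A B x \<longleftrightarrow> (\<forall>j\<in>B - {i}. card {k\<in>B. x k \<le> x j} \<le> card {k\<in>A. x k \<le> x j})"
    unfolding ballot_def using at_max assms(3) by force
  also have "\<dots> \<longleftrightarrow> ballot (A - {i}) (B - {i}) x"
    unfolding ballot_def by (intro ball_cong refl) (simp add: below_max)
  finally show ?thesis .
qed

lemma borel_measurable_card_Collect [measurable (raw)]:
  assumes "finite A" and [measurable]: "\<And>i. i \<in> A \<Longrightarrow> Measurable.pred M (P i)"
  shows "(\<lambda>x. card {i\<in>A. P i x}) \<in> borel_measurable M"
proof -
  have "card {i\<in>A. P i x} = (\<Sum>i\<in>A. if P i x then 1 else 0)" for x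
    using assms(1) by (simp add: sum.If_cases Int_def)
  then show ?thesis
    by simp measurable
qed

definition ballot_prob :: "nat \<Rightarrow> nat \<Rightarrow> real" where
  "ballot_prob a b = (real a - real b + 1) / (real a + 1)"

lemma ballot_prob_nonneg: "b \<le> Suc a \<Longrightarrow> 0 \<le> ballot_prob a b"
  by (simp add: ballot_prob_def)

lemma ballot_prob_recursion:
  assumes "0 < a"
  shows "real a * ballot_prob (a - 1) b + real b * ballot_prob a (b - 1) = real (a + b) * ballot_prob a b"
proof -
  obtain n where a: "a = Suc n"
    using assms gr0_implies_Suc by blast
  show ?thesis
    by (cases b) (simp_all add: ballot_prob_def a divide_simps, simp_all add: algebra_simps)
qed

lemma sum_ballot_prob_remove:
  assumes "finite A" "finite B" "A \<inter> B = {}" "A \<noteq> {}"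
  shows "(\<Sum>i\<in>A \<union> B. ballot_prob (card (A - {i})) (card (B - {i}))) =
    real (card A + card B) * ballot_prob (card A) (card B)"
proof -
  have "(\<Sum>i\<in>A \<union> B. ballot_prob (card (A - {i})) (card (B - {i}))) =
      (\<Sum>i\<in>A. ballot_prob (card (A - {i})) (card (B - {i}))) +
      (\<Sum>i\<in>B. ballot_prob (card (A - {i})) (card (B - {i})))"
    using assms by (intro sum.union_disjoint)
  also have "\<dots> = (\<Sum>i\<in>A. ballot_prob (card A - 1) (card B)) + (\<Sum>i\<in>B. ballot_prob (card A) (card B - 1))"
    using assms(3)
    by (intro arg_cong2[where f="(+)"] sum.cong) (auto simp: card_Diff_singleton_if disjoint_iff)
  also have "\<dots> = real (card A + card B) * ballot_prob (card A) (card B)"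
    using assms ballot_prob_recursion[of "card A" "card B"] by (simp add: card_gt_0_iff)
  finally show ?thesis .
qed

context atomless_prob_space
begin

lemma measurable_ballot [measurable]:
  assumes "finite A" "finite B" "A \<union> B \<subseteq> I"
  shows "Measurable.pred (iid I M) (ballot A B)"
proof -
  have [measurable]: "(\<lambda>x. x i) \<in> borel_measurable (iid I M)" if "i \<in> A \<union> B" for i
    using that assms(3) by (intro borel_measurable_iid_component) auto
  show ?thesis
    unfolding ballot_def using assms by measurable
qed

definition ballot_mass :: "'i set \<Rightarrow> 'i set \<Rightarrow> 'a set \<Rightarrow> ennreal" where
  "ballot_mass A B D = emeasure (iid (A \<union> B) M)
     {x\<in>space (iid (A \<union> B) M). (\<forall>j\<in>A \<union> B. x j \<in> D) \<and> ballot A B x}"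

lemma emeasure_ballot_strict_max_at:
  fixes A B :: "'i set"
  assumes "finite A" "finite B" "card B \<le> card A" "i \<in> A \<union> B"
    and [measurable]: "D \<in> sets borel" and lower: "\<And>w. w \<in> D \<Longrightarrow> {..<w} \<subseteq> D"
  shows "emeasure (iid (A \<union> B) M) {x\<in>space (iid (A \<union> B) M).
      strict_max_at (A \<union> B) x i \<and> (\<forall>j\<in>A \<union> B. x j \<in> D) \<and> ballot A B x} =
    (\<integral>\<^sup>+w\<in>D. ballot_mass (A - {i}) (B - {i}) {..<w} \<partial>M)"
proof -
  let ?ballot = "ballot (A - {i}) (B - {i}) :: ('i \<Rightarrow> 'a) \<Rightarrow> bool"
  have "strict_max_at (A \<union> B) x i \<and> (\<forall>j\<in>A \<union> B. x j \<in> D) \<and> ballot A B x \<longleftrightarrow>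
      strict_max_at (A \<union> B) x i \<and> x i \<in> D \<and> ?ballot x" for x
    using ballot_remove_max[OF assms(1-4), of x] assms(4) lower[of "x i"]
    by (auto simp: strict_max_at_def)
  moreover have "Measurable.pred (iid (A \<union> B) M) ?ballot"
    using assms(1,2) by (intro measurable_ballot) auto
  ultimately show ?thesis
    using assms(1,2,4) by (simp add: ballot_mass_def emeasure_strict_max_at ballot_fun_upd Un_Diff)
qed

lemma ballot_mass_recursion:
  assumes "finite A" "finite B" "card B \<le> card A" "A \<noteq> {}"
    and "D \<in> sets borel" "\<And>w. w \<in> D \<Longrightarrow> {..<w} \<subseteq> D"
  shows "ballot_mass A B D = (\<Sum>i\<in>A \<union> B. \<integral>\<^sup>+w\<in>D. ballot_mass (A - {i}) (B - {i}) {..<w} \<partial>M)"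
proof -
  note [measurable] = assms(5)
  have "finite (A \<union> B)" and [measurable]: "Measurable.pred (iid (A \<union> B) M) (ballot A B)"
    using assms(1,2) by (auto intro: measurable_ballot)
  then have "Measurable.pred (iid (A \<union> B) M) (\<lambda>x. (\<forall>j\<in>A \<union> B. x j \<in> D) \<and> ballot A B x)"
    by measurable
  then show ?thesis
    using assms(1,2,4) emeasure_ballot_strict_max_at[OF assms(1-3) _ assms(5,6)]
    unfolding ballot_mass_def[of A B] by (subst emeasure_eq_sum_strict_max_at) auto
qed

lemma ballot_mass_step:
  assumes fin: "finite A" "finite B" and disjoint: "A \<inter> B = {}" and card: "card B \<le> card A" "A \<noteq> {}"
    and D: "D \<in> sets borel" "\<And>w. w \<in> D \<Longrightarrow> {..<w} \<subseteq> D"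
    and removed: "\<And>i w. i \<in> A \<union> B \<Longrightarrow> ballot_mass (A - {i}) (B - {i}) {..<w} =
      ennreal (ballot_prob (card (A - {i})) (card (B - {i}))) * emeasure M {..<w} ^ (card A + card B - 1)"
  shows "ballot_mass A B D = ennreal (ballot_prob (card A) (card B)) * emeasure M D ^ (card A + card B)"
proof -
  let ?n = "card A + card B - 1"
  let ?p = "\<lambda>i. ballot_prob (card (A - {i})) (card (B - {i}))"
  let ?G = "\<integral>\<^sup>+w\<in>D. emeasure M {..<w} ^ ?n \<partial>M"
  note [measurable] = D(1)
  have Suc_n: "Suc ?n = card A + card B"
    using fin card(2) by (simp add: card_gt_0_iff)
  have nonneg: "0 \<le> ?p i" for i
    using fin card(1) by (intro ballot_prob_nonneg) (auto simp: card_Diff_singleton_if)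
  have "ballot_mass A B D = (\<Sum>i\<in>A \<union> B. ennreal (?p i) * ?G)"
    using ballot_mass_recursion[OF fin card D] by (simp add: removed nn_integral_cmult mult.assoc)
  also have "\<dots> = ennreal (\<Sum>i\<in>A \<union> B. ?p i) * ?G"
    by (simp add: sum_distrib_right[symmetric] sum_ennreal nonneg)
  also have "(\<Sum>i\<in>A \<union> B. ?p i) = real (Suc ?n) * ballot_prob (card A) (card B)"
    unfolding Suc_n using fin disjoint card(2) by (rule sum_ballot_prob_remove)
  also have "ennreal \<dots> * ?G = ennreal (ballot_prob (card A) (card B)) * (of_nat (Suc ?n) * ?G)"
    using ballot_prob_nonneg[of "card B" "card A"] card(1)
    by (subst ennreal_mult) (auto simp: mult_ac ennreal_of_nat_eq_real_of_nat)
  also have "of_nat (Suc ?n) * ?G = emeasure M D ^ (card A + card B)"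
    using nn_integral_emeasure_lessThan_power[OF D, of ?n] by (simp only: Suc_n)
  finally show ?thesis .
qed

text \<open>
  The lower set \<open>D\<close> carries the induction: once the largest point \<open>w\<close> is known, the others are
  confined to \<open>{..<w}\<close>. The case \<open>card B = card A + 1\<close>, where the probability vanishes, is reached
  when \<open>card A = card B\<close> and the largest point lies in \<open>A\<close>.
\<close>

lemma ballot_mass_eq:
  assumes "finite A" "finite B" "A \<inter> B = {}" "card B \<le> Suc (card A)"
    and "D \<in> sets borel" "\<And>w. w \<in> D \<Longrightarrow> {..<w} \<subseteq> D"
  shows "ballot_mass A B D = ennreal (ballot_prob (card A) (card B)) * emeasure M D ^ (card A + card B)"
  using assms
proof (induction "card A + card B" arbitrary: A B D rule: less_induct)
  case less
  note fin = less.prems(1,2)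
  consider (too_many) "card B = Suc (card A)" | (empty) "A = {}" "B = {}" | (step) "card B \<le> card A" "A \<noteq> {}"
    using fin less.prems(4) by (metis card.empty card_0_eq le_Suc_eq le_zero_eq)
  then show ?case
  proof cases
    case too_many
    then show ?thesis
      by (simp add: ballot_mass_def not_ballot[OF fin] ballot_prob_def)
  next
    case empty
    then show ?thesis
      by (simp add: ballot_mass_def ballot_def ballot_prob_def space_PiM)
  next
    case step
    show ?thesis
    proof (rule ballot_mass_step[OF fin less.prems(3) step less.prems(5,6)])
      fix i w assume i: "i \<in> A \<union> B"
      have card: "card (A - {i}) + card (B - {i}) = card A + card B - 1"
          "card (B - {i}) \<le> Suc (card (A - {i}))"
        using i fin less.prems(3) step card_Suc_Diff1[OF fin(1), of i] card_Suc_Diff1[OF fin(2), of i]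
        by (auto simp: card_Diff_singleton_if disjoint_iff)
      show "ballot_mass (A - {i}) (B - {i}) {..<w} =
          ennreal (ballot_prob (card (A - {i})) (card (B - {i}))) * emeasure M {..<w} ^ (card A + card B - 1)"
        unfolding card(1)[symmetric] using card fin less.prems(3) step(2)
        by (intro less.hyps) (auto simp: card_gt_0_iff)
    qed
  qed
qed

lemma measure_ballot:
  fixes A B :: "'i set"
  assumes "finite A" "finite B" "A \<inter> B = {}" "card B \<le> Suc (card A)"
  shows "\<P>(x in iid (A \<union> B) M. ballot A B x) = ballot_prob (card A) (card B)"
  using ballot_mass_eq[OF assms, of UNIV] emeasure_space_1 ballot_prob_nonneg[OF assms(4)]
  by (simp add: ballot_mass_def measure_def)

end

section \<open>The distribution function of an atomless distribution\<close>

context atomless_prob_space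
begin

lemma isCont_measure_atMost: "isCont (\<lambda>t. measure M {..t}) t"
  unfolding isCont_def tendsto_at_iff_sequentially
proof (intro allI impI)
  fix X :: "nat \<Rightarrow> 'a" assume X: "X \<longlonglongrightarrow> t"
  have "(\<lambda>n. \<integral>x. indicator {..X n} x \<partial>M) \<longlonglongrightarrow> (\<integral>x. indicator {..t} x \<partial>M :: real)"
  proof (rule integral_dominated_convergence[where w="\<lambda>_. 1"])
    show "AE x in M. (\<lambda>n. indicator {..X n} x :: real) \<longlonglongrightarrow> indicator {..t} x"
      using AE_neq[of t]
    proof eventually_elim
      case (elim x)
      then consider (less) "x < t" | (greater) "t < x" by force
      then have "eventually (\<lambda>n. indicator {..X n} x = (indicator {..t} x :: real)) sequentially"
      proof cases
        case less
        with order_tendstoD(1)[OF X this] show ?thesis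
          by (auto elim!: eventually_mono)
      next
        case greater
        with order_tendstoD(2)[OF X this] show ?thesis
          by (auto elim!: eventually_mono)
      qed
      then show ?case by (rule tendsto_eventually)
    qed
  qed auto
  then show "((\<lambda>t. measure M {..t}) \<circ> X) \<longlonglongrightarrow> measure M {..t}"
    by (simp add: comp_def)
qed

lemma continuous_on_measure_atMost: "continuous_on A (\<lambda>t. measure M {..t})"
  using isCont_measure_atMost by (simp add: continuous_at_imp_continuous_on)

lemma borel_measurable_measure_atMost [measurable]: "(\<lambda>t. measure M {..t}) \<in> borel_measurable borel"
  by (intro borel_measurable_continuous_onI continuous_on_measure_atMost)

lemma measure_atMost_mono: "s \<le> t \<Longrightarrow> measure M {..s} \<le> measure M {..t}"
  by (intro finite_measure_mono) auto

lemma integral_measure_atMost: "(\<integral>x. measure M {..x} \<partial>M) = 1 / 2"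
proof -
  have "emeasure M {..x} = emeasure M {..<x}" for x
    using AE_neq[of x] by (intro emeasure_eq_AE) (auto elim!: eventually_mono)
  then have "2 * (\<integral>\<^sup>+x. ennreal (measure M {..x}) \<partial>M) = 1"
    using nn_integral_emeasure_lessThan_power[of UNIV 1] emeasure_space_1
    by (simp add: emeasure_eq_measure)
  moreover have "(\<integral>\<^sup>+x. ennreal (measure M {..x}) \<partial>M) = ennreal (\<integral>x. measure M {..x} \<partial>M)"
    by (intro nn_integral_eq_integral integrable_const_bound[of _ 1]) auto
  moreover have "2 * ennreal r = ennreal (2 * r)" for r
    using ennreal_mult'[of 2 r] by simp
  ultimately have "ennreal (2 * (\<integral>x. measure M {..x} \<partial>M)) = ennreal 1"
    by simp
  then show ?thesis
    by (subst (asm) ennreal_inj) auto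
qed

end

lemma measure_atMost_surj:
  fixes M :: "ereal measure"
  assumes "atomless_prob_space M" "v \<in> {0..1}"
  obtains t where "measure M {..t} = v"
proof -
  interpret atomless_prob_space M by fact
  have "{..- \<infinity>} = {- \<infinity> :: ereal}" "{..\<infinity>} = (UNIV :: ereal set)"
    by auto
  then have "measure M {..- \<infinity>} = 0" "measure M {..\<infinity>} = 1"
    using prob_space by (auto simp: measure_def[of M "{- \<infinity>}"])
  then have "\<exists>t\<ge>- \<infinity>. t \<le> \<infinity> \<and> measure M {..t} = v"
    using assms(2) by (intro IVT' continuous_on_measure_atMost) auto
  then show ?thesis using that by blast
qed

text \<open>
  The distribution function \<open>F\<close> need not be injective, but the largest point \<open>s\<close> with
  \<open>F s = F t\<close> satisfies \<open>{x. F x \<le> F t} = {..s}\<close>, which exceeds \<open>{..t}\<close> by a null set.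
\<close>

lemma AE_measure_atMost_le_iff:
  fixes M :: "ereal measure"
  assumes "atomless_prob_space M"
  shows "AE x in M. measure M {..x} \<le> measure M {..t} \<longleftrightarrow> x \<le> t"
proof -
  interpret atomless_prob_space M by fact
  let ?F = "\<lambda>t. measure M {..t}"
  let ?L = "{x. ?F x = ?F t}"
  have "closed ?L"
    using continuous_closed_vimage[of "{?F t}" ?F] isCont_measure_atMost by (simp add: vimage_def)
  then have "Sup ?L \<in> ?L"
    by (rule closed_contains_Sup_cl) auto
  then have "?F (Sup ?L) = ?F t" "t \<le> Sup ?L"
    by (auto intro: Sup_upper)
  moreover have "x \<le> Sup ?L" if "?F x \<le> ?F t" for x
  proof (cases "x \<le> t")
    case False
    then have "?F x = ?F t"
      using that measure_atMost_mono[of t x] by simp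
    then show ?thesis by (intro Sup_upper) simp
  qed (use \<open>t \<le> Sup ?L\<close> in order)
  ultimately have "AE x in M. x \<notin> {..Sup ?L} - {..t}"
    by (intro AE_not_in) (auto simp: null_sets_def emeasure_eq_measure finite_measure_Diff)
  then show ?thesis
  proof eventually_elim
    case (elim x)
    then show ?case
      using \<open>\<And>x. ?F x \<le> ?F t \<Longrightarrow> x \<le> Sup ?L\<close>[of x] measure_atMost_mono[of x t] by auto
  qed
qed

lemma measure_measure_atMost_le:
  fixes M :: "ereal measure"
  assumes "atomless_prob_space M" "v \<in> {0..1}"
  shows "measure M {x. measure M {..x} \<le> v} = v"
proof -
  interpret atomless_prob_space M by fact
  obtain t where t: "measure M {..t} = v"
    using assms by (rule measure_atMost_surj)
  have "measure M {x\<in>space M. measure M {..x} \<le> measure M {..t}} = measure M {..t}"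
    using AE_measure_atMost_le_iff[OF assms(1), of t] by (intro finite_measure_eq_AE) auto
  then show ?thesis by (simp add: t)
qed

section \<open>Measures determined by their distribution functions\<close>

lemma sets_PiM_eq_sigma_sets_boxes:
  assumes "finite I" and E: "sets N = sigma_sets \<Omega> E" "E \<subseteq> Pow \<Omega>" "\<Omega> \<in> E"
  shows "sets (PiM I (\<lambda>_. N)) = sigma_sets (\<Pi>\<^sub>E i\<in>I. \<Omega>) (Pi\<^sub>E I ` (I \<rightarrow> E))"
proof -
  let ?\<Omega> = "\<Pi>\<^sub>E i\<in>I. \<Omega>"
  let ?G = "{{f\<in>?\<Omega>. \<forall>i\<in>j. f i \<in> A i} | A j. j \<in> {I} \<and> A \<in> Pi j (\<lambda>_. E)}"
  have "?G = (\<lambda>A. {f\<in>?\<Omega>. \<forall>i\<in>I. f i \<in> A i}) ` (I \<rightarrow> E)"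
    by auto
  also have "\<dots> = Pi\<^sub>E I ` (I \<rightarrow> E)"
  proof (rule image_cong[OF refl])
    fix A assume "A \<in> I \<rightarrow> E"
    then have "A i \<subseteq> \<Omega>" if "i \<in> I" for i
      using that E(2) by blast
    then show "{f\<in>?\<Omega>. \<forall>i\<in>I. f i \<in> A i} = Pi\<^sub>E I A"
      by (auto simp: PiE_iff extensional_def)
  qed
  finally have boxes: "?G = Pi\<^sub>E I ` (I \<rightarrow> E)" .
  have "sets (PiM I (\<lambda>_. N)) = sets (PiM I (\<lambda>_. sigma \<Omega> E))"
    using E by (intro sets_PiM_cong) auto
  also have "\<dots> = sets (sigma ?\<Omega> ?G)"
    using assms by (intro sets_PiM_sigma) (auto intro!: exI[of _ "{\<Omega>}"])
  also have "\<dots> = sigma_sets ?\<Omega> ?G"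
    by (intro sets_measure_of) auto
  finally show ?thesis
    unfolding boxes .
qed

lemma Int_stable_boxes:
  assumes "Int_stable E"
  shows "Int_stable (Pi\<^sub>E I ` (I \<rightarrow> E))"
proof (rule Int_stableI_image)
  fix A B assume boxes: "A \<in> I \<rightarrow> E" "B \<in> I \<rightarrow> E"
  have "A i \<inter> B i \<in> E" if "i \<in> I" for i
    using that boxes by (intro Int_stableD[OF assms]) auto
  then show "\<exists>C\<in>I \<rightarrow> E. Pi\<^sub>E I A \<inter> Pi\<^sub>E I B = Pi\<^sub>E I C"
    by (intro bexI[of _ "\<lambda>i. A i \<inter> B i"]) (auto simp: PiE_Int)
qed

lemma prob_measure_eqI_boxes:
  assumes "finite I" and Q: "prob_space Q" "prob_space R"
    and sets: "sets Q = sets (PiM I (\<lambda>_. N))" "sets R = sets (PiM I (\<lambda>_. N))"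
    and N: "sets N = sigma_sets \<Omega> (g ` T)" "g ` T \<subseteq> Pow \<Omega>" "\<Omega> \<in> g ` T" "Int_stable (g ` T)"
    and eq_boxes: "\<And>u. u \<in> I \<rightarrow>\<^sub>E T \<Longrightarrow> measure Q (\<Pi>\<^sub>E i\<in>I. g (u i)) = measure R (\<Pi>\<^sub>E i\<in>I. g (u i))"
  shows "Q = R"
proof -
  interpret Q: prob_space Q by fact
  interpret R: prob_space R by fact
  let ?G = "Pi\<^sub>E I ` (I \<rightarrow> g ` T)" and ?\<Omega> = "\<Pi>\<^sub>E i\<in>I. \<Omega>"
  have sigma: "sets (PiM I (\<lambda>_. N)) = sigma_sets ?\<Omega> ?G"
    using assms(1) N(1-3) by (rule sets_PiM_eq_sigma_sets_boxes)
  have emeasure_box_eq: "emeasure Q (Pi\<^sub>E I A) = emeasure R (Pi\<^sub>E I A)" if A: "A \<in> I \<rightarrow> g ` T" for A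
  proof -
    have "\<forall>i\<in>I. \<exists>t. t \<in> T \<and> A i = g t"
      using A by blast
    then obtain u where u: "\<forall>i\<in>I. u i \<in> T \<and> A i = g (u i)"
      by metis
    then have "Pi\<^sub>E I A = (\<Pi>\<^sub>E i\<in>I. g (restrict u I i))"
      by (intro PiE_cong) simp
    moreover have "restrict u I \<in> I \<rightarrow>\<^sub>E T"
      using u by simp
    ultimately show ?thesis
      by (simp only: Q.emeasure_eq_measure R.emeasure_eq_measure eq_boxes)
  qed
  show ?thesis
  proof (rule measure_eqI_generator_eq[where E="?G" and \<Omega>="?\<Omega>" and A="\<lambda>_. ?\<Omega>"])
    show "Int_stable ?G"
      using N(4) by (rule Int_stable_boxes)
    show "?G \<subseteq> Pow ?\<Omega>"
    proof (intro image_subsetI PowI PiE_mono)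
      fix A i assume "A \<in> I \<rightarrow> g ` T" "i \<in> I"
      then show "A i \<subseteq> \<Omega>" using N(2) by blast
    qed
    show "range (\<lambda>_::nat. ?\<Omega>) \<subseteq> ?G"
      using N(3) by auto
  qed (use sigma sets emeasure_box_eq in auto)
qed

lemma sets_borel_eq_sigma_sets_atMost:
  "sets (borel :: 'a::{linorder_topology, second_countable_topology} measure) = sigma_sets UNIV (range atMost)"
proof -
  have compl: "{x<..} = UNIV - {..x}" "{..x} = UNIV - {x<..}" for x :: 'a
    by auto
  have "sets (borel :: 'a measure) = sigma_sets UNIV (range greaterThan)"
    by (subst borel_Ioi) (simp add: sets_measure_of)
  also have "\<dots> = sigma_sets UNIV (range atMost)"
  proof (rule sigma_sets_eqI)
    fix A :: "'a set" assume "A \<in> range greaterThan"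
    then show "A \<in> sigma_sets UNIV (range atMost)"
      unfolding compl(1) by (auto intro: sigma_sets.Compl)
  next
    fix A :: "'a set" assume "A \<in> range atMost"
    then show "A \<in> sigma_sets UNIV (range greaterThan)"
      unfolding compl(2) by (auto intro: sigma_sets.Compl)
  qed
  finally show ?thesis .
qed

lemma sets_unit_interval_eq_sigma_sets:
  "sets (restrict_space borel {0..1::real}) = sigma_sets {0..1} ((\<lambda>u. {0..u}) ` {0..1})"
proof -
  have "sets (restrict_space borel {0..1::real}) = sigma_sets {0..1} ((\<inter>) {0..1} ` range atMost)"
    unfolding sets_restrict_space sets_borel_eq_sigma_sets_atMost
    by (rule sigma_sets_Int) (auto simp: sets_borel_eq_sigma_sets_atMost[symmetric])
  also have "\<dots> = sigma_sets {0..1} ((\<lambda>u. {0..u}) ` {0..1})"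
  proof (rule sigma_sets_eqI)
    fix A :: "real set" assume "A \<in> (\<inter>) {0..1} ` range atMost"
    then obtain x where "A = {0..1} \<inter> {..x}" by blast
    then have "A = {0..min x 1}" by auto
    then show "A \<in> sigma_sets {0..1} ((\<lambda>u. {0..u}) ` {0..1})"
      by (cases "0 \<le> x") (auto intro: sigma_sets.Basic sigma_sets.Empty)
  next
    fix A :: "real set" assume "A \<in> (\<lambda>u. {0..u}) ` {0..1}"
    then obtain x where "x \<le> 1" "A = {0..x}" by auto
    then have "A = {0..1} \<inter> {..x}" by auto
    then show "A \<in> sigma_sets {0..1} ((\<inter>) {0..1} ` range atMost)"
      by (intro sigma_sets.Basic) blast
  qed
  finally show ?thesis .
qed

abbreviation cube_space :: "nat \<Rightarrow> (nat \<Rightarrow> real) measure" where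
  "cube_space d \<equiv> PiM {1..d} (\<lambda>_. restrict_space borel {0..1})"

lemma space_cube_space: "space (cube_space d) = unit_cube d"
  by (auto simp: space_PiM unit_cube_def space_restrict_space)

lemma copula_measure_eqI:
  assumes "prob_space Q" and "sets Q = sets (cube_space d)"
    and "\<And>u. u \<in> unit_cube d \<Longrightarrow> measure Q (\<Pi>\<^sub>E k\<in>{1..d}. {0..u k}) = C u"
  shows "copula_measure d C = Q"
  unfolding copula_measure_def
proof (rule the_equality)
  fix R assume R: "prob_space R \<and> sets R = sets (cube_space d) \<and>
     (\<forall>u\<in>unit_cube d. measure R (\<Pi>\<^sub>E k\<in>{1..d}. {0..u k}) = C u)"
  show "R = Q"
  proof (rule prob_measure_eqI_boxes[OF _ _ _ _ _ sets_unit_interval_eq_sigma_sets])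
    show "Int_stable ((\<lambda>u. {0..u}) ` {0..1::real})"
    proof (rule Int_stableI_image)
      fix s t :: real assume "s \<in> {0..1}" "t \<in> {0..1}"
      then show "\<exists>u\<in>{0..1}. {0..s} \<inter> {0..t} = {0..u}"
        by (intro bexI[of _ "min s t"]) auto
    qed
  qed (use R assms in \<open>auto simp: unit_cube_def\<close>)
qed (use assms in blast)

lemma df_measure_eqI:
  assumes "prob_space Q" and "sets Q = sets (ereal_space d)"
    and "\<And>x. x \<in> space (ereal_space d) \<Longrightarrow> measure Q (\<Pi>\<^sub>E k\<in>{1..d}. {..x k}) = H x"
  shows "df_measure d H = Q"
  unfolding df_measure_def
proof (rule the_equality)
  fix R assume R: "prob_space R \<and> sets R = sets (ereal_space d) \<and>
     (\<forall>x\<in>space (ereal_space d). measure R (\<Pi>\<^sub>E k\<in>{1..d}. {..x k}) = H x)"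
  show "R = Q"
  proof (rule prob_measure_eqI_boxes[OF _ _ _ _ _ sets_borel_eq_sigma_sets_atMost])
    show "Int_stable (range atMost :: ereal set set)"
    proof (rule Int_stableI_image)
      fix s t :: ereal
      show "\<exists>u\<in>UNIV. {..s} \<inter> {..t} = {..u}"
        by (intro bexI[of _ "min s t"]) auto
    qed
    show "(UNIV :: ereal set) \<in> range atMost"
      by (intro image_eqI[of _ _ \<infinity>]) auto
  qed (use R assms in \<open>auto simp: space_PiM\<close>)
qed (use assms in blast)

section \<open>Copulas of random vectors\<close>

lemma sum_Pow_prod_if:
  fixes f g :: "'i \<Rightarrow> 'a::comm_ring_1"
  assumes "finite I"
  shows "(\<Sum>J\<in>Pow I. (- 1) ^ card J * (\<Prod>i\<in>I. if i \<in> J then f i else g i)) = (\<Prod>i\<in>I. g i - f i)"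
proof -
  have "(\<Prod>i\<in>I. if i \<in> J then f i else g i) = prod f J * prod g (I - J)" if "J \<in> Pow I" for J
  proof -
    have "I \<inter> {i. i \<in> J} = J" "I \<inter> - {i. i \<in> J} = I - J"
      using that by auto
    then show ?thesis
      by (simp add: prod.If_cases assms)
  qed
  then show ?thesis
    using assms by (simp add: prod_diff_conv_sum mult.assoc)
qed

lemma borel_measurable_cube_component [measurable (raw)]:
  assumes "k \<in> {1..d}"
  shows "(\<lambda>v. v k) \<in> borel_measurable (cube_space d)"
proof -
  have "(\<lambda>x::real. x) \<in> borel_measurable (restrict_space borel {0..1})"
    by (rule measurable_restrict_space1) simp
  from measurable_compose[OF measurable_component_singleton[OF assms] this] show ?thesis .
qed

definition cube_df :: "nat \<Rightarrow> (nat \<Rightarrow> real) measure \<Rightarrow> (nat \<Rightarrow> real) \<Rightarrow> real" where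
  "cube_df d R = (\<lambda>u\<in>unit_cube d. measure R (\<Pi>\<^sub>E k\<in>{1..d}. {0..u k}))"

locale uniform_margins = prob_space R
  for R :: "(nat \<Rightarrow> real) measure" +
  fixes d :: nat
  assumes sets_eq_cube_space [measurable_cong]: "sets R = sets (cube_space d)"
    and prob_component_le: "\<And>k t. k \<in> {1..d} \<Longrightarrow> t \<in> {0..1} \<Longrightarrow> \<P>(v in R. v k \<le> t) = t"
begin

lemma space_eq_unit_cube: "space R = unit_cube d"
  using sets_eq_imp_space_eq[OF sets_eq_cube_space] by (simp only: space_cube_space)

lemma cube_df_eq_prob:
  assumes "u \<in> unit_cube d"
  shows "cube_df d R u = \<P>(v in R. \<forall>k\<in>{1..d}. v k \<le> u k)"
proof -
  have "(\<Pi>\<^sub>E k\<in>{1..d}. {0..u k}) = (\<Pi>\<^sub>E k\<in>{1..d}. {0..1} \<inter> {..u k})"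
    using assms by (intro PiE_cong) (auto simp: unit_cube_def PiE_iff)
  also have "\<dots> = {v\<in>space R. \<forall>k\<in>{1..d}. v k \<le> u k}"
    by (auto simp: space_eq_unit_cube unit_cube_def PiE_iff extensional_def)
  finally have "(\<Pi>\<^sub>E k\<in>{1..d}. {0..u k}) = {v\<in>space R. \<forall>k\<in>{1..d}. v k \<le> u k}" .
  then show ?thesis
    using assms by (simp add: cube_df_def)
qed

lemma cube_df_eq_integral:
  assumes "u \<in> unit_cube d"
  shows "cube_df d R u = (\<integral>v. (\<Prod>k=1..d. indicator {..u k} (v k)) \<partial>R)"
proof -
  have "(\<Prod>k=1..d. indicator {..u k} (v k)) = (indicator {v. \<forall>k\<in>{1..d}. v k \<le> u k} v :: real)" for v
    by (auto split: split_indicator simp: prod_zero_iff simp del: atLeastAtMost_iff)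
  moreover have "{v. \<forall>k\<in>{1..d}. v k \<le> u k} \<inter> space R = {v\<in>space R. \<forall>k\<in>{1..d}. v k \<le> u k}"
    by auto
  ultimately show ?thesis
    by (simp add: cube_df_eq_prob[OF assms])
qed

lemma cube_df_volume_nonneg:
  assumes "a \<in> unit_cube d" "b \<in> unit_cube d" "\<forall>k\<in>{1..d}. a k \<le> b k"
  shows "0 \<le> (\<Sum>J\<in>Pow {1..d}. (- 1) ^ card J * cube_df d R (\<lambda>k\<in>{1..d}. if k \<in> J then a k else b k))"
proof -
  let ?c = "\<lambda>J. \<lambda>k\<in>{1..d}. if k \<in> J then a k else b k"
  let ?below = "\<lambda>u v k. indicator {..u k} (v k) :: real"
  have corner: "?c J \<in> unit_cube d" for J
    using assms(1,2) by (auto simp: unit_cube_def PiE_iff)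
  have integrable: "integrable R (\<lambda>v. \<Prod>k=1..d. ?below u v k)" for u
    by (rule integrable_const_bound[of _ 1]) (auto intro!: AE_I2 prod_le_1 simp: abs_prod)
  have "(\<Sum>J\<in>Pow {1..d}. (- 1) ^ card J * cube_df d R (?c J)) =
      (\<integral>v. (\<Sum>J\<in>Pow {1..d}. (- 1) ^ card J * (\<Prod>k=1..d. ?below (?c J) v k)) \<partial>R)"
    unfolding cube_df_eq_integral[OF corner] using integrable[of "?c J" for J]
    by (subst Bochner_Integration.integral_sum) (auto simp del: restrict_apply)
  also have "\<dots> = (\<integral>v. (\<Prod>k=1..d. ?below b v k - ?below a v k) \<partial>R)"
  proof (rule Bochner_Integration.integral_cong[OF refl])
    fix v
    have "(\<Prod>k=1..d. ?below (?c J) v k) = (\<Prod>k=1..d. if k \<in> J then ?below a v k else ?below b v k)" for J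
      by (intro prod.cong) auto
    then show "(\<Sum>J\<in>Pow {1..d}. (- 1) ^ card J * (\<Prod>k=1..d. ?below (?c J) v k)) =
        (\<Prod>k=1..d. ?below b v k - ?below a v k)"
      by (simp only: sum_Pow_prod_if finite_atLeastAtMost)
  qed
  also have "\<dots> \<ge> 0"
    using assms(3) by (intro integral_nonneg_AE AE_I2 prod_nonneg) (force split: split_indicator)
  finally show ?thesis .
qed

lemma is_copula_cube_df: "is_copula d (cube_df d R)"
  unfolding is_copula_def
proof (intro conjI ballI impI cube_df_volume_nonneg)
  show "cube_df d R \<in> unit_cube d \<rightarrow>\<^sub>E {0..1}"
    by (auto simp: cube_df_def)
next
  fix u assume u: "u \<in> unit_cube d" and "\<exists>k\<in>{1..d}. u k = 0"
  then obtain k where k: "k \<in> {1..d}" "u k = 0" by blast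
  have "cube_df d R u \<le> prob {v\<in>space R. v k \<le> 0}"
    unfolding cube_df_eq_prob[OF u] using k by (intro finite_measure_mono) force+
  also have "\<dots> = 0"
    using k(1) by (intro prob_component_le) auto
  finally show "cube_df d R u = 0"
    by (simp add: cube_df_eq_prob[OF u] order_antisym)
next
  fix k and t :: real assume k: "k \<in> {1..d}" and t: "t \<in> {0..1}"
  let ?u = "\<lambda>j\<in>{1..d}. if j = k then t else 1"
  have "{v\<in>space R. \<forall>j\<in>{1..d}. v j \<le> ?u j} = {v\<in>space R. v k \<le> t}"
    using k by (auto simp: space_eq_unit_cube unit_cube_def PiE_iff)
  moreover have "?u \<in> unit_cube d"
    using t by (auto simp: unit_cube_def)
  ultimately show "cube_df d R ?u = t"
    using prob_component_le[OF k t] by (simp only: cube_df_eq_prob)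
qed auto

lemma copula_measure_cube_df: "copula_measure d (cube_df d R) = R"
  using prob_space_axioms sets_eq_cube_space by (rule copula_measure_eqI) (simp add: cube_df_def)

lemma borel_measurable_cube_df: "cube_df d R \<in> borel_measurable R"
proof -
  have [measurable]: "(\<lambda>p. fst p k) \<in> borel_measurable (R \<Otimes>\<^sub>M R)"
      "(\<lambda>p. snd p k) \<in> borel_measurable (R \<Otimes>\<^sub>M R)"
    if "k \<in> {1..d}" for k
    using that by (auto intro: measurable_compose[OF measurable_fst] measurable_compose[OF measurable_snd])
  have "(\<lambda>u. prob {v\<in>space R. \<forall>k\<in>{1..d}. v k \<le> u k}) \<in> borel_measurable R"
    by (intro measurable_measure) (auto simp: space_pair_measure, measurable)
  then show ?thesis
    by (rule measurable_cong[THEN iffD1, rotated]) (simp add: space_eq_unit_cube cube_df_eq_prob)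
qed

end

definition margin :: "(nat \<Rightarrow> ereal) measure \<Rightarrow> nat \<Rightarrow> ereal measure" where
  "margin Q k = distr Q borel (\<lambda>x. x k)"

abbreviation margin_cdf :: "(nat \<Rightarrow> ereal) measure \<Rightarrow> nat \<Rightarrow> ereal \<Rightarrow> real" where
  "margin_cdf Q k t \<equiv> measure (margin Q k) {..t}"

definition rank_transform :: "nat \<Rightarrow> (nat \<Rightarrow> ereal) measure \<Rightarrow> (nat \<Rightarrow> ereal) \<Rightarrow> nat \<Rightarrow> real" where
  "rank_transform d Q x = (\<lambda>k\<in>{1..d}. margin_cdf Q k (x k))"

definition copula_of :: "nat \<Rightarrow> (nat \<Rightarrow> ereal) measure \<Rightarrow> (nat \<Rightarrow> real) \<Rightarrow> real" where
  "copula_of d Q = cube_df d (distr Q (cube_space d) (rank_transform d Q))"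

locale atomless_margins = prob_space Q
  for Q :: "(nat \<Rightarrow> ereal) measure" +
  fixes d :: nat
  assumes sets_eq_ereal_space [measurable_cong]: "sets Q = sets (ereal_space d)"
    and AE_component_neq: "\<And>k c. k \<in> {1..d} \<Longrightarrow> AE x in Q. x k \<noteq> c"
begin

lemma space_eq_PiE: "space Q = ({1..d} \<rightarrow>\<^sub>E UNIV)"
  using sets_eq_imp_space_eq[OF sets_eq_ereal_space] by (simp add: space_PiM)

lemma borel_measurable_component [measurable (raw)]:
  "k \<in> {1..d} \<Longrightarrow> (\<lambda>x. x k) \<in> borel_measurable Q"
  using measurable_component_singleton[of k "{1..d}" "\<lambda>_. borel"] sets_eq_ereal_space
  by (simp cong: measurable_cong_sets)

lemma atMost_box_eq: "(\<Pi>\<^sub>E k\<in>{1..d}. {..t k}) = {x\<in>space Q. \<forall>k\<in>{1..d}. x k \<le> t k}"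
  by (auto simp: space_eq_PiE PiE_iff extensional_def)

lemma atomless_margin:
  assumes k: "k \<in> {1..d}"
  shows "atomless_prob_space (margin Q k)"
proof -
  have meas: "(\<lambda>x. x k) \<in> borel_measurable Q"
    using k by (rule borel_measurable_component)
  then interpret margin: prob_space "margin Q k"
    unfolding margin_def by (rule prob_space_distr)
  show ?thesis
  proof
    fix c
    have "AE y in margin Q k. y \<noteq> c"
      unfolding margin_def using AE_component_neq[OF k, of c] meas by (subst AE_distr_iff) auto
    then show "emeasure (margin Q k) {c} = 0"
      by (subst (asm) AE_iff_measurable[OF _ refl]) (auto simp: margin_def)
  qed (simp add: margin_def)
qed

lemma margin_cdf_eq_prob: "k \<in> {1..d} \<Longrightarrow> margin_cdf Q k t = \<P>(x in Q. x k \<le> t)"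
  by (subst margin_def, subst measure_distr) (auto intro!: arg_cong[where f=prob])

lemma marginal_df_eq_margin_cdf:
  assumes "k \<in> {1..d}"
  shows "marginal_df d (\<lambda>x. prob (\<Pi>\<^sub>E k\<in>{1..d}. {..x k})) k t = margin_cdf Q k t"
proof -
  have "{x\<in>space Q. \<forall>j\<in>{1..d}. x j \<le> (\<lambda>j\<in>{1..d}. if j = k then t else \<infinity>) j} = {x\<in>space Q. x k \<le> t}"
    using assms by auto
  then show ?thesis
    unfolding marginal_df_def atMost_box_eq by (simp only: margin_cdf_eq_prob[OF assms])
qed

lemma rank_transform_in_unit_cube: "rank_transform d Q x \<in> unit_cube d"
  by (auto simp: rank_transform_def unit_cube_def margin_cdf_eq_prob)

lemma rank_transform_surj:
  assumes "u \<in> unit_cube d"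
  obtains x where "x \<in> space (ereal_space d)" "u = rank_transform d Q x"
proof -
  have "\<exists>t. margin_cdf Q k t = u k" if "k \<in> {1..d}" for k
    using measure_atMost_surj[OF atomless_margin[OF that], of "u k"] that assms
    by (auto simp: unit_cube_def PiE_iff)
  then obtain x where "margin_cdf Q k (x k) = u k" if "k \<in> {1..d}" for k
    by metis
  moreover have "u \<in> extensional {1..d}"
    using assms by (simp add: unit_cube_def PiE_def)
  ultimately have "u = rank_transform d Q (restrict x {1..d})"
    by (auto simp: rank_transform_def fun_eq_iff extensional_def)
  with that[of "restrict x {1..d}"] show ?thesis
    by (simp add: space_PiM)
qed

lemma measurable_rank_transform: "rank_transform d Q \<in> measurable Q (cube_space d)"
proof -
  have "(\<lambda>x. margin_cdf Q k (x k)) \<in> measurable Q (restrict_space borel {0..1})" if "k \<in> {1..d}" for k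
    using that by (intro measurable_restrict_space2 measurable_compose[OF borel_measurable_component
        atomless_prob_space.borel_measurable_measure_atMost[OF atomless_margin]])
      (auto simp: margin_cdf_eq_prob)
  then show ?thesis
    unfolding rank_transform_def[abs_def] by (intro measurable_restrict)
qed

lemma uniform_margins_rank_transform: "uniform_margins (distr Q (cube_space d) (rank_transform d Q)) d"
proof -
  interpret R: prob_space "distr Q (cube_space d) (rank_transform d Q)"
    using measurable_rank_transform by (rule prob_space_distr)
  show ?thesis
  proof
    fix k and t :: real assume k: "k \<in> {1..d}" and t: "t \<in> {0..1}"
    interpret margin: atomless_prob_space "margin Q k"
      using k by (rule atomless_margin)
    have meas: "{v\<in>space (cube_space d). v k \<le> t} \<in> sets (cube_space d)"
      using k by measurable
    have "R.prob {v\<in>space (cube_space d). v k \<le> t} =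
        prob (rank_transform d Q -` {v\<in>space (cube_space d). v k \<le> t} \<inter> space Q)"
      using measurable_rank_transform meas by (rule measure_distr)
    also have "rank_transform d Q -` {v\<in>space (cube_space d). v k \<le> t} \<inter> space Q =
        (\<lambda>x. x k) -` {y. margin_cdf Q k y \<le> t} \<inter> space Q"
      using k rank_transform_in_unit_cube
      by (auto simp: space_cube_space[unfolded One_nat_def] rank_transform_def)
    also have "prob \<dots> = measure (margin Q k) {y. margin_cdf Q k y \<le> t}"
      unfolding margin_def using margin.borel_measurable_measure_atMost k
      by (intro measure_distr[symmetric]) (auto simp: margin_def)
    also have "\<dots> = t"
      using margin.atomless_prob_space_axioms t by (rule measure_measure_atMost_le)
    finally show "R.prob {v\<in>space (distr Q (cube_space d) (rank_transform d Q)). v k \<le> t} = t"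
      by simp
  qed simp
qed

lemma AE_rank_transform_le_iff:
  "AE x in Q. \<forall>k\<in>{1..d}. rank_transform d Q x k \<le> rank_transform d Q t k \<longleftrightarrow> x k \<le> t k"
proof (rule AE_finite_allI)
  fix k assume k: "k \<in> {1..d}"
  have "AE x in Q. margin_cdf Q k (x k) \<le> margin_cdf Q k (t k) \<longleftrightarrow> x k \<le> t k"
    unfolding margin_def
    by (rule AE_distrD[OF borel_measurable_component[OF k] AE_measure_atMost_le_iff[OF atomless_margin[OF k],
          unfolded margin_def]])
  then show "AE x in Q. rank_transform d Q x k \<le> rank_transform d Q t k \<longleftrightarrow> x k \<le> t k"
    using k by (simp add: rank_transform_def)
qed simp

lemma copula_of_Sklar: "copula_of d Q (rank_transform d Q t) = prob (\<Pi>\<^sub>E k\<in>{1..d}. {..t k})"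
proof -
  let ?R = "distr Q (cube_space d) (rank_transform d Q)"
  interpret R: uniform_margins ?R d
    by (rule uniform_margins_rank_transform)
  let ?B = "{v\<in>space (cube_space d). \<forall>k\<in>{1..d}. v k \<le> rank_transform d Q t k}"
  have sets_box: "?B \<in> sets (cube_space d)"
    by measurable
  have "copula_of d Q (rank_transform d Q t) = measure ?R ?B"
    unfolding copula_of_def R.cube_df_eq_prob[OF rank_transform_in_unit_cube] space_distr ..
  also have "\<dots> = prob (rank_transform d Q -` ?B \<inter> space Q)"
    using measurable_rank_transform sets_box by (rule measure_distr)
  also have "\<dots> = prob {x\<in>space Q. \<forall>k\<in>{1..d}. x k \<le> t k}"
  proof (rule finite_measure_eq_AE)
    show "AE x in Q. x \<in> rank_transform d Q -` ?B \<inter> space Q \<longleftrightarrow> x \<in> {x\<in>space Q. \<forall>k\<in>{1..d}. x k \<le> t k}"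
      using AE_rank_transform_le_iff[of t]
      by eventually_elim (use rank_transform_in_unit_cube in \<open>simp only: space_cube_space, blast\<close>)
    show "rank_transform d Q -` ?B \<inter> space Q \<in> sets Q"
      using measurable_rank_transform sets_box by (rule measurable_sets)
  qed measurable
  finally show ?thesis
    unfolding atMost_box_eq .
qed

lemma borel_measurable_prob_atMost_box: "(\<lambda>y. prob (\<Pi>\<^sub>E k\<in>{1..d}. {..y k})) \<in> borel_measurable Q"
proof -
  have "copula_of d Q \<in> borel_measurable (cube_space d)"
    using uniform_margins.borel_measurable_cube_df[OF uniform_margins_rank_transform]
    by (simp add: copula_of_def)
  then show ?thesis
    unfolding copula_of_Sklar[symmetric] by (rule measurable_compose[OF measurable_rank_transform])
qed

lemma copula_of_unique:
  assumes "C \<in> extensional (unit_cube d)"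
    and "\<And>x. x \<in> space (ereal_space d) \<Longrightarrow> prob (\<Pi>\<^sub>E k\<in>{1..d}. {..x k}) = C (rank_transform d Q x)"
  shows "C = copula_of d Q"
proof (rule extensionalityI[OF assms(1)])
  show "copula_of d Q \<in> extensional (unit_cube d)"
    by (simp add: copula_of_def cube_df_def)
  fix u assume "u \<in> unit_cube d"
  then obtain x where "x \<in> space (ereal_space d)" "u = rank_transform d Q x"
    by (rule rank_transform_surj)
  then show "C u = copula_of d Q u"
    using assms(2) by (simp add: copula_of_Sklar)
qed

lemma copula_bracket_copula_of:
  "copula_bracket d (copula_of d Q) (copula_of d Q) = (\<integral>y. prob (\<Pi>\<^sub>E k\<in>{1..d}. {..y k}) \<partial>Q)"
proof -
  let ?R = "distr Q (cube_space d) (rank_transform d Q)"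
  interpret R: uniform_margins ?R d
    by (rule uniform_margins_rank_transform)
  have "copula_bracket d (copula_of d Q) (copula_of d Q) = (\<integral>u. copula_of d Q u \<partial>?R)"
    unfolding copula_bracket_def copula_of_def R.copula_measure_cube_df ..
  also have "\<dots> = (\<integral>y. copula_of d Q (rank_transform d Q y) \<partial>Q)"
    using measurable_rank_transform R.borel_measurable_cube_df
    by (intro integral_distr) (simp_all add: copula_of_def)
  finally show ?thesis
    by (simp only: copula_of_Sklar)
qed

end

section \<open>Order statistics\<close>

definition ordstat :: "'i set \<Rightarrow> ('i \<Rightarrow> 'a::linorder) \<Rightarrow> nat \<Rightarrow> 'a" where
  "ordstat I x k = (MIN J\<in>{J. J \<subseteq> I \<and> card J = k}. Max (x ` J))"

lemma ordstat_le_iff: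
  assumes "finite I" and k: "k \<in> {1..card I}"
  shows "ordstat I x k \<le> t \<longleftrightarrow> k \<le> card {i\<in>I. x i \<le> t}"
proof -
  let ?F = "{J. J \<subseteq> I \<and> card J = k}"
  have "?F \<noteq> {}"
    using k obtain_subset_with_card_n[of k I] by auto
  then have "ordstat I x k \<le> t \<longleftrightarrow> (\<exists>J\<in>?F. Max (x ` J) \<le> t)"
    unfolding ordstat_def using assms(1) by (subst Min_le_iff) auto
  also have "\<dots> \<longleftrightarrow> (\<exists>J\<in>?F. J \<subseteq> {i\<in>I. x i \<le> t})"
  proof (intro bex_cong refl)
    fix J assume J: "J \<in> ?F"
    then have "finite J" "J \<noteq> {}"
      using k assms(1) by (auto intro: finite_subset)
    then show "Max (x ` J) \<le> t \<longleftrightarrow> J \<subseteq> {i\<in>I. x i \<le> t}"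
      using J by auto
  qed
  also have "\<dots> \<longleftrightarrow> k \<le> card {i\<in>I. x i \<le> t}"
  proof
    assume "\<exists>J\<in>?F. J \<subseteq> {i\<in>I. x i \<le> t}"
    then show "k \<le> card {i\<in>I. x i \<le> t}"
      using assms(1) by (auto intro!: card_mono)
  next
    assume "k \<le> card {i\<in>I. x i \<le> t}"
    then obtain J where "J \<subseteq> {i\<in>I. x i \<le> t}" "card J = k"
      by (rule obtain_subset_with_card_n)
    then show "\<exists>J\<in>?F. J \<subseteq> {i\<in>I. x i \<le> t}"
      by (intro bexI[of _ J]) auto
  qed
  finally show ?thesis .
qed

lemma ordstat_in_image:
  assumes "finite I" and k: "k \<in> {1..card I}"
  shows "ordstat I x k \<in> x ` I"
proof -
  let ?F = "{J. J \<subseteq> I \<and> card J = k}"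
  have "?F \<noteq> {}"
    using k obtain_subset_with_card_n[of k I] by auto
  then have "ordstat I x k \<in> (\<lambda>J. Max (x ` J)) ` ?F"
    unfolding ordstat_def using assms(1) by (intro Min_in) auto
  then obtain J where J: "J \<in> ?F" "ordstat I x k = Max (x ` J)"
    by auto
  then have "Max (x ` J) \<in> x ` J"
    using k assms(1) by (intro Max_in) (auto intro: finite_subset)
  then show ?thesis
    using J by auto
qed

lemma ordstat_le_ordstat_iff:
  assumes "finite I"
  shows "(\<forall>k\<in>{1..card I}. ordstat I x k \<le> ordstat I y k) \<longleftrightarrow>
    (\<forall>j\<in>I. card {i\<in>I. y i \<le> y j} \<le> card {i\<in>I. x i \<le> y j})"
proof (intro iffI ballI)
  fix j assume ordstat_le: "\<forall>k\<in>{1..card I}. ordstat I x k \<le> ordstat I y k" and j: "j \<in> I"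
  let ?k = "card {i\<in>I. y i \<le> y j}"
  have "?k \<noteq> 0" "?k \<le> card I"
    using j assms by (auto intro: card_mono)
  then have k: "?k \<in> {1..card I}" by simp
  have "ordstat I x ?k \<le> ordstat I y ?k" using ordstat_le k ..
  also have "\<dots> \<le> y j" using ordstat_le_iff[OF assms k] by blast
  finally show "?k \<le> card {i\<in>I. x i \<le> y j}"
    by (simp only: ordstat_le_iff[OF assms k])
next
  fix k assume card_le: "\<forall>j\<in>I. card {i\<in>I. y i \<le> y j} \<le> card {i\<in>I. x i \<le> y j}" and k: "k \<in> {1..card I}"
  obtain j where j: "j \<in> I" "ordstat I y k = y j"
    using ordstat_in_image[OF assms k] by blast
  have "k \<le> card {i\<in>I. y i \<le> y j}"
    using ordstat_le_iff[OF assms k, of y "y j"] j(2) by simp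
  with card_le j(1) have "k \<le> card {i\<in>I. x i \<le> y j}"
    by (meson order_trans)
  then show "ordstat I x k \<le> ordstat I y k"
    by (simp only: j(2) ordstat_le_iff[OF assms k])
qed

lemma ballot_Inl_Inr_iff:
  "ballot (Inl ` I) (Inr ` I) z \<longleftrightarrow>
    (\<forall>j\<in>I. card {i\<in>I. z (Inr i) \<le> z (Inr j)} \<le> card {i\<in>I. z (Inl i) \<le> z (Inr j)})"
proof -
  have "{i \<in> f ` I. z i \<le> t} = f ` {i\<in>I. z (f i) \<le> t}" for f :: "'a \<Rightarrow> 'a + 'a" and t
    by auto
  then show ?thesis
    by (simp add: ballot_def card_image)
qed

lemma distr_iid_Plus:
  fixes I :: "'i set" and J :: "'j set" and M :: "'a measure"
  assumes "finite I" "finite J" and M: "prob_space M"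
  shows "distr (iid (I <+> J) M) (iid I M \<Otimes>\<^sub>M iid J M)
      (\<lambda>z. (\<lambda>i\<in>I. z (Inl i), \<lambda>j\<in>J. z (Inr j))) = iid I M \<Otimes>\<^sub>M iid J M"
    (is "distr _ ?IJ ?split = _")
proof -
  interpret M: prob_space M by fact
  interpret P: product_sigma_finite "\<lambda>_::'i + 'j. M"
    by unfold_locales
  let ?L = "iid (Inl ` I :: ('i + 'j) set) M" and ?R = "iid (Inr ` J :: ('i + 'j) set) M"
  let ?l = "\<lambda>z :: 'i + 'j \<Rightarrow> 'a. \<lambda>i\<in>I. z (Inl i)" and ?r = "\<lambda>z :: 'i + 'j \<Rightarrow> 'a. \<lambda>j\<in>J. z (Inr j)"
  have distr_l: "distr ?L (iid I M) ?l = iid I M"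
    using distr_PiM_reindex[of "Inl ` I" "\<lambda>_. M" Inl I] M by auto
  have distr_r: "distr ?R (iid J M) ?r = iid J M"
    using distr_PiM_reindex[of "Inr ` J" "\<lambda>_. M" Inr J] M by auto
  have lr_meas: "?l \<in> measurable ?L (iid I M)" "?r \<in> measurable ?R (iid J M)"
    by (auto intro!: measurable_restrict measurable_component_singleton)
  have split_meas: "?split \<in> measurable (iid (I <+> J) M) ?IJ"
    by (intro measurable_Pair measurable_restrict measurable_component_singleton) auto
  have merge: "distr (?L \<Otimes>\<^sub>M ?R) (iid (I <+> J) M) (merge (Inl ` I) (Inr ` J)) = iid (I <+> J) M"
    using assms(1,2) unfolding Plus_def by (intro P.distr_merge) auto
  have "distr (iid (I <+> J) M) ?IJ ?split =
      distr (distr (?L \<Otimes>\<^sub>M ?R) (iid (I <+> J) M) (merge (Inl ` I) (Inr ` J))) ?IJ ?split"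
    by (simp only: merge)
  also have "\<dots> = distr (?L \<Otimes>\<^sub>M ?R) ?IJ (?split \<circ> merge (Inl ` I) (Inr ` J))"
    using split_meas measurable_merge[of "Inl ` I" "Inr ` J"] unfolding Plus_def by (intro distr_distr)
  also have "\<dots> = distr (?L \<Otimes>\<^sub>M ?R) ?IJ (\<lambda>(z, w). (?l z, ?r w))"
    by (rule distr_cong) (auto simp: merge_def fun_eq_iff split_beta)
  also have "\<dots> = ?IJ"
    using lr_meas by (subst pair_measure_distr[symmetric])
      (auto simp: distr_l distr_r intro!: prob_space_imp_sigma_finite prob_space_PiM M)
  finally show ?thesis .
qed

lemma borel_measurable_ordstat:
  fixes M :: "('i \<Rightarrow> 'a::{linorder_topology, second_countable_topology}) measure"
  assumes "finite I" "k \<in> {1..card I}" and [measurable]: "\<And>i. i \<in> I \<Longrightarrow> (\<lambda>x. x i) \<in> borel_measurable M"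
  shows "(\<lambda>x. ordstat I x k) \<in> borel_measurable M"
proof (rule borel_measurableI_le)
  fix t
  show "{x\<in>space M. ordstat I x k \<le> t} \<in> sets M"
    unfolding ordstat_le_iff[OF assms(1,2)] using assms(1) by measurable
qed

lemma sets_ordstat_le_ordstat:
  fixes M :: "('i \<Rightarrow> 'a::{linorder_topology, second_countable_topology}) measure"
  assumes "finite I" and "\<And>i. i \<in> I \<Longrightarrow> (\<lambda>x. x i) \<in> borel_measurable M"
  shows "{p\<in>space (M \<Otimes>\<^sub>M M). \<forall>k\<in>{1..card I}. ordstat I (fst p) k \<le> ordstat I (snd p) k}
    \<in> sets (M \<Otimes>\<^sub>M M)"
proof -
  have [measurable]: "(\<lambda>x. ordstat I x k) \<in> borel_measurable M" if "k \<in> {1..card I}" for k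
    using assms(1) that assms(2) by (rule borel_measurable_ordstat)
  show ?thesis
    by measurable
qed

lemma (in atomless_prob_space) prob_ordstat_le:
  fixes I :: "'i set"
  assumes "finite I"
  shows "\<P>(p in iid I M \<Otimes>\<^sub>M iid I M. \<forall>k\<in>{1..card I}. ordstat I (fst p) k \<le> ordstat I (snd p) k) =
    1 / (real (card I) + 1)"
proof -
  let ?P = "iid I M" and ?PP = "iid (I <+> I) M"
  let ?split = "\<lambda>z. (\<lambda>i\<in>I. z (Inl i), \<lambda>j\<in>I. z (Inr j))"
  let ?E = "{p\<in>space (?P \<Otimes>\<^sub>M ?P). \<forall>k\<in>{1..card I}. ordstat I (fst p) k \<le> ordstat I (snd p) k}"
  have split_meas: "?split \<in> measurable ?PP (?P \<Otimes>\<^sub>M ?P)"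
    by (intro measurable_Pair measurable_restrict measurable_component_singleton) auto
  have "measure (?P \<Otimes>\<^sub>M ?P) ?E = measure (distr ?PP (?P \<Otimes>\<^sub>M ?P) ?split) ?E"
    by (simp only: distr_iid_Plus[OF assms assms prob_space_axioms])
  also have "\<dots> = measure ?PP (?split -` ?E \<inter> space ?PP)"
    using split_meas sets_ordstat_le_ordstat[OF assms borel_measurable_iid_component] by (rule measure_distr)
  also have "?split -` ?E \<inter> space ?PP = {z\<in>space ?PP. ballot (Inl ` I) (Inr ` I) z}"
    using measurable_space[OF split_meas]
    by (auto simp: ordstat_le_ordstat_iff[OF assms] ballot_Inl_Inr_iff simp del: One_nat_def cong: conj_cong)
  also have "measure ?PP \<dots> = ballot_prob (card I) (card I)"
    using measure_ballot[of "Inl ` I" "Inr ` I"] assms by (auto simp: Plus_def card_image)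
  finally show ?thesis
    by (simp add: ballot_prob_def)
qed

section \<open>Order transforms\<close>

lemma order_map_eq: "order_map d x = (\<lambda>k\<in>{1..d}. ordstat {1..d} x k)"
  by (simp add: order_map_def ordstat_def setcompr_eq_image)

lemma measurable_order_map: "order_map d \<in> measurable (ereal_space d) (ereal_space d)"
proof -
  have "(\<lambda>x. ordstat {1..d} x k) \<in> borel_measurable (ereal_space d)" if "k \<in> {1..d}" for k
    using that by (intro borel_measurable_ordstat) auto
  then show ?thesis
    unfolding order_map_eq[abs_def] by (intro measurable_restrict) auto
qed

lemma atomless_margins_order_map:
  assumes "atomless_margins Q d"
  shows "atomless_margins (distr Q (ereal_space d) (order_map d)) d"
proof -
  interpret atomless_margins Q d by fact
  have order_map: "order_map d \<in> measurable Q (ereal_space d)"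
    using measurable_order_map sets_eq_ereal_space by (simp cong: measurable_cong_sets)
  then interpret order: prob_space "distr Q (ereal_space d) (order_map d)"
    by (rule prob_space_distr)
  show ?thesis
  proof
    fix k c assume k: "k \<in> {1..d}"
    have "AE x in Q. \<forall>i\<in>{1..d}. x i \<noteq> c"
      by (intro AE_finite_allI AE_component_neq) auto
    then have "AE x in Q. order_map d x k \<noteq> c"
    proof eventually_elim
      case (elim x)
      then show ?case
        using ordstat_in_image[of "{1..d}" k x] k by (auto simp: order_map_eq)
    qed
    then show "AE x in distr Q (ereal_space d) (order_map d). x k \<noteq> c"
      using order_map k by (subst AE_distr_iff) auto
  qed simp
qed

lemma (in pair_prob_space) measure_pair_measure_alt2:
  assumes A: "A \<in> sets (M1 \<Otimes>\<^sub>M M2)"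
  shows "measure (M1 \<Otimes>\<^sub>M M2) A = (\<integral>y. measure M1 ((\<lambda>x. (x, y)) -` A) \<partial>M2)"
proof -
  have "emeasure (M1 \<Otimes>\<^sub>M M2) A = (\<integral>\<^sup>+y. ennreal (measure M1 ((\<lambda>x. (x, y)) -` A)) \<partial>M2)"
    by (simp add: emeasure_pair_measure_alt2[OF A] M1.emeasure_eq_measure)
  moreover have "(\<lambda>y. measure M1 ((\<lambda>x. (x, y)) -` A)) \<in> borel_measurable M2"
    using measurable_emeasure_Pair2[OF A] by (simp add: measure_def)
  ultimately show ?thesis
    by (subst integral_eq_nn_integral) (auto simp: measure_def)
qed

lemma (in atomless_margins) copula_bracket_copula_of_order_map:
  defines "R \<equiv> distr Q (ereal_space d) (order_map d)"
  shows "copula_bracket d (copula_of d R) (copula_of d R) =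
    \<P>(p in Q \<Otimes>\<^sub>M Q. \<forall>k\<in>{1..d}. ordstat {1..d} (fst p) k \<le> ordstat {1..d} (snd p) k)"
    (is "_ = measure _ ?E")
proof -
  interpret R: atomless_margins R d
    unfolding R_def using atomless_margins_axioms by (rule atomless_margins_order_map)
  interpret QQ: pair_prob_space Q Q
    by unfold_locales
  have order_map: "order_map d \<in> measurable Q (ereal_space d)"
    using measurable_order_map sets_eq_ereal_space by (simp cong: measurable_cong_sets)
  have "copula_bracket d (copula_of d R) (copula_of d R) = (\<integral>y. R.prob (\<Pi>\<^sub>E k\<in>{1..d}. {..y k}) \<partial>R)"
    by (rule R.copula_bracket_copula_of)
  also have "\<dots> = (\<integral>y. R.prob (\<Pi>\<^sub>E k\<in>{1..d}. {..order_map d y k}) \<partial>Q)"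
    using order_map R.borel_measurable_prob_atMost_box unfolding R_def
    by (intro integral_distr) (simp_all cong: measurable_cong_sets)
  also have "\<dots> = (\<integral>y. prob ((\<lambda>x. (x, y)) -` ?E) \<partial>Q)"
  proof (rule Bochner_Integration.integral_cong[OF refl])
    fix y assume y: "y \<in> space Q"
    have "R.prob (\<Pi>\<^sub>E k\<in>{1..d}. {..order_map d y k}) =
        prob (order_map d -` (\<Pi>\<^sub>E k\<in>{1..d}. {..order_map d y k}) \<inter> space Q)"
      unfolding R_def using order_map by (intro measure_distr sets_PiM_I_finite) auto
    also have "order_map d -` (\<Pi>\<^sub>E k\<in>{1..d}. {..order_map d y k}) \<inter> space Q = (\<lambda>x. (x, y)) -` ?E"
      using y by (auto simp: order_map_eq PiE_iff space_pair_measure)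
    finally show "R.prob (\<Pi>\<^sub>E k\<in>{1..d}. {..order_map d y k}) = prob ((\<lambda>x. (x, y)) -` ?E)" .
  qed
  also have "\<dots> = measure (Q \<Otimes>\<^sub>M Q) ?E"
    using sets_ordstat_le_ordstat[of "{1..d}" Q] borel_measurable_component
    by (subst QQ.measure_pair_measure_alt2) simp_all
  finally show ?thesis .
qed

lemma order_transform_eq_copula_of:
  assumes "atomless_margins (df_measure d (copula_df d C)) d"
  shows "order_transform d C =
    copula_of d (distr (df_measure d (copula_df d C)) (ereal_space d) (order_map d))" (is "_ = copula_of d ?Q")
proof -
  interpret atomless_margins ?Q d
    using assms by (rule atomless_margins_order_map)
  have ranks: "(\<lambda>k\<in>{1..d}. marginal_df d (order_df d C) k (x k)) = rank_transform d ?Q x" for x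
    unfolding rank_transform_def order_df_def[abs_def] by (intro restrict_ext marginal_df_eq_margin_cdf)
  have copula: "is_copula d (copula_of d ?Q)"
    unfolding copula_of_def using uniform_margins_rank_transform by (rule uniform_margins.is_copula_cube_df)
  show ?thesis
    unfolding order_transform_def ranks
  proof (rule the_equality)
    show "is_copula d (copula_of d ?Q) \<and>
        (\<forall>x\<in>space (ereal_space d). order_df d C x = copula_of d ?Q (rank_transform d ?Q x))"
      using copula by (simp add: copula_of_Sklar order_df_def del: One_nat_def)
    fix D
    assume "is_copula d D \<and> (\<forall>x\<in>space (ereal_space d). order_df d C x = D (rank_transform d ?Q x))"
    then show "D = copula_of d ?Q"
      by (intro copula_of_unique) (auto simp: is_copula_def PiE_def order_df_def)
  qed
qed

section \<open>Independent components\<close>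

lemma atomless_margins_iid:
  assumes "atomless_prob_space M"
  shows "atomless_margins (iid {1..d} M) d"
proof -
  interpret M: atomless_prob_space M by fact
  interpret P: prob_space "iid {1..d} M"
    by (intro prob_space_PiM M.prob_space_axioms)
  show ?thesis
  proof
    show "sets (iid {1..d} M) = sets (ereal_space d)"
      by (intro sets_PiM_cong) auto
    show "AE x in iid {1..d} M. x k \<noteq> c" if "k \<in> {1..d}" for k c
      using that M.prob_space_axioms M.AE_neq by (intro AE_PiM_component[of _ "\<lambda>_. M"])
  qed
qed

lemma measure_iid_box:
  assumes "prob_space M" "finite I" "\<And>i. i \<in> I \<Longrightarrow> A i \<in> sets M"
  shows "measure (iid I M) (Pi\<^sub>E I A) = (\<Prod>i\<in>I. measure M (A i))"
proof -
  interpret M: prob_space M by fact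
  interpret finite_product_prob_space "\<lambda>_. M" I
    using assms(2) by unfold_locales
  show ?thesis
    using assms(3) by (rule prob_times)
qed

lemma product_copula_eq_copula_of:
  assumes "atomless_prob_space M"
  shows "product_copula d = copula_of d (iid {1..d} M)"
proof -
  interpret M: atomless_prob_space M by fact
  let ?P = "iid {1..d} M"
  interpret P: atomless_margins ?P d
    using assms by (rule atomless_margins_iid)
  have margin: "margin ?P k = M" if "k \<in> {1..d}" for k
    using distr_PiM_component[of "{1..d}" "\<lambda>_. M" k] that M.prob_space_axioms
    by (simp add: margin_def cong: distr_cong)
  show ?thesis
  proof (rule P.copula_of_unique)
    fix x
    have "measure ?P (\<Pi>\<^sub>E k\<in>{1..d}. {..x k}) = (\<Prod>k=1..d. measure M {..x k})"
      by (intro measure_iid_box M.prob_space_axioms) auto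
    also have "\<dots> = product_copula d (rank_transform d ?P x)"
      using P.rank_transform_in_unit_cube[of x]
      by (simp add: product_copula_def rank_transform_def margin del: One_nat_def)
    finally show "measure ?P (\<Pi>\<^sub>E k\<in>{1..d}. {..x k}) = product_copula d (rank_transform d ?P x)" .
  qed (simp add: product_copula_def)
qed

lemma copula_bracket_copula_of_iid:
  assumes "atomless_prob_space M"
  shows "copula_bracket d (copula_of d (iid {1..d} M)) (copula_of d (iid {1..d} M)) = 1 / 2 ^ d"
proof -
  interpret M: atomless_prob_space M by fact
  let ?P = "iid {1..d} M"
  interpret P: atomless_margins ?P d
    using assms by (rule atomless_margins_iid)
  interpret product: product_sigma_finite "\<lambda>_. M"
    by unfold_locales
  have "copula_bracket d (copula_of d ?P) (copula_of d ?P) = (\<integral>y. measure ?P (\<Pi>\<^sub>E k\<in>{1..d}. {..y k}) \<partial>?P)"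
    by (rule P.copula_bracket_copula_of)
  also have "\<dots> = (\<integral>y. (\<Prod>k=1..d. measure M {..y k}) \<partial>?P)"
    by (intro Bochner_Integration.integral_cong refl measure_iid_box M.prob_space_axioms) auto
  also have "\<dots> = (\<Prod>k=1..d. \<integral>t. measure M {..t} \<partial>M)"
    by (intro product.product_integral_prod M.integrable_const_bound[of _ 1]) auto
  also have "\<dots> = 1 / 2 ^ d"
    by (simp add: M.integral_measure_atMost power_one_over)
  finally show ?thesis .
qed

lemma copula_bracket_copula_of_order_map_iid:
  fixes d :: nat
  assumes "atomless_prob_space M"
  defines "Q \<equiv> distr (iid {1..d} M) (ereal_space d) (order_map d)"
  shows "copula_bracket d (copula_of d Q) (copula_of d Q) = 1 / (real d + 1)"
proof -
  interpret M: atomless_prob_space M by fact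
  show ?thesis
    unfolding Q_def atomless_margins.copula_bracket_copula_of_order_map[OF atomless_margins_iid[OF assms(1)]]
    using M.prob_ordstat_le[of "{1..d}"] by simp
qed

section \<open>The product copula\<close>

definition uniform_ereal :: "ereal measure" where
  "uniform_ereal = distr (uniform_measure lborel {0..1}) borel ereal"

lemma atomless_uniform_ereal: "atomless_prob_space uniform_ereal"
proof -
  interpret unif: prob_space "uniform_measure lborel {0..1::real}"
    by (intro prob_space_uniform_measure) auto
  interpret prob_space uniform_ereal
    unfolding uniform_ereal_def by (rule unif.prob_space_distr) simp
  show ?thesis
  proof
    fix c :: ereal
    have "ereal -` {c} \<subseteq> {real_of_ereal c}"
      by auto
    then have "emeasure lborel ({0..1} \<inter> ereal -` {c}) \<le> emeasure lborel {real_of_ereal c}"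
      by (intro emeasure_mono) auto
    moreover have "ereal -` {c} \<in> sets borel"
      by (rule measurable_sets_borel[of _ borel]) auto
    ultimately show "emeasure uniform_ereal {c} = 0"
      unfolding uniform_ereal_def by (subst emeasure_distr) (auto simp: divide_ennreal_def)
  qed (simp add: uniform_ereal_def)
qed

lemma measure_uniform_ereal_atMost: "measure uniform_ereal {..t} = real_of_ereal (max 0 (min t 1))"
proof -
  have "ereal -` {..t} \<in> sets borel"
    by (rule measurable_sets_borel[of _ borel]) auto
  then have "measure uniform_ereal {..t} = measure lborel ({0..1} \<inter> ereal -` {..t})"
    unfolding uniform_ereal_def by (subst measure_distr) auto
  also have "\<dots> = real_of_ereal (max 0 (min t 1))"
  proof (cases t)
    case (real r)
    then have "{0..1} \<inter> ereal -` {..t} = {0..min 1 r}"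
      by auto
    then show ?thesis
      using real by (auto simp: max_def min_def one_ereal_def zero_ereal_def)
  next
    case PInf
    then have "ereal -` {..t} = UNIV" by auto
    then show ?thesis using PInf by simp
  next
    case MInf
    then have "ereal -` {..t} = {}" by auto
    then show ?thesis using MInf by simp
  qed
  finally show ?thesis .
qed

lemma df_measure_product_copula:
  "df_measure d (copula_df d (product_copula d)) = iid {1..d} uniform_ereal"
proof (rule df_measure_eqI)
  interpret unif: atomless_prob_space uniform_ereal
    by (rule atomless_uniform_ereal)
  interpret atomless_margins "iid {1..d} uniform_ereal" d
    by (rule atomless_margins_iid[OF atomless_uniform_ereal])
  show "prob_space (iid {1..d} uniform_ereal)" "sets (iid {1..d} uniform_ereal) = sets (ereal_space d)"
    by (fact prob_space_axioms sets_eq_ereal_space)+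
  fix x
  have "(\<lambda>k\<in>{1..d}. measure uniform_ereal {..x k}) \<in> unit_cube d"
    by (auto simp: unit_cube_def)
  then have "copula_df d (product_copula d) x = (\<Prod>k=1..d. measure uniform_ereal {..x k})"
    by (simp add: copula_df_def product_copula_def measure_uniform_ereal_atMost)
  then show "prob (\<Pi>\<^sub>E k\<in>{1..d}. {..x k}) = copula_df d (product_copula d) x"
    by (simp add: measure_iid_box unif.prob_space_axioms)
qed

lemma order_transform_product_copula:
  "order_transform d (product_copula d) =
    copula_of d (distr (iid {1..d} uniform_ereal) (ereal_space d) (order_map d))"
  using order_transform_eq_copula_of[of d "product_copula d"] atomless_margins_iid[OF atomless_uniform_ereal]
  by (simp only: df_measure_product_copula)

lemma copula_bracket_product_copula: "copula_bracket d (product_copula d) (product_copula d) = 1 / 2 ^ d"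
  unfolding product_copula_eq_copula_of[OF atomless_uniform_ereal]
  by (rule copula_bracket_copula_of_iid[OF atomless_uniform_ereal])

lemma copula_bracket_order_transform_product_copula:
  "copula_bracket d (order_transform d (product_copula d)) (order_transform d (product_copula d)) =
    1 / (real d + 1)"
  unfolding order_transform_product_copula
  by (rule copula_bracket_copula_of_order_map_iid[OF atomless_uniform_ereal])

lemma kendall_tau_product_copula: "kendall_tau d (product_copula d) = 0"
  by (simp add: kendall_tau_def copula_bracket_product_copula)

lemma kendall_tau_order_transform_product_copula:
  assumes "d \<ge> 2"
  shows "kendall_tau d (order_transform d (product_copula d)) =
    (2 ^ d - (real d + 1)) / ((2 ^ (d - 1) - 1) * (real d + 1))"
proof -
  have "(1::real) < 2 ^ (d - 1)"
    using assms by (intro one_less_power) auto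
  then show ?thesis
    by (simp add: kendall_tau_def copula_bracket_order_transform_product_copula field_simps)
qed

lemma Suc_less_two_power: "d \<ge> 2 \<Longrightarrow> Suc d < 2 ^ d"
  by (induction d rule: nat_induct_at_least) auto

theorem theorem6p2:
  "(\<forall>d::nat. d \<ge> 2 \<longrightarrow>
      (copula_bracket d (product_copula d) (product_copula d) = 1 / 2 ^ d \<and>
       1 / 2 ^ d < 1 / (real d + 1) \<and>
       1 / (real d + 1) =
         copula_bracket d (order_transform d (product_copula d)) (order_transform d (product_copula d))) \<and>
      (kendall_tau d (product_copula d) = 0 \<and>
       0 < (2 ^ d - (real d + 1)) / ((2 ^ (d - 1) - 1) * (real d + 1)) \<and>
       (2 ^ d - (real d + 1)) / ((2 ^ (d - 1) - 1) * (real d + 1)) =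
         kendall_tau d (order_transform d (product_copula d)))) \<and>
   (\<lambda>d. kendall_tau d (order_transform d (product_copula d))) \<longlonglongrightarrow> 0"
proof (intro conjI allI impI)
  fix d :: nat assume d: "d \<ge> 2"
  have "real (Suc d) < real (2 ^ d)"
    using Suc_less_two_power[OF d] by (simp only: of_nat_less_iff)
  then have Suc_less: "real d + 1 < 2 ^ d" by simp
  then show "1 / 2 ^ d < 1 / (real d + 1)"
    by (simp add: field_simps)
  have "(1::real) < 2 ^ (d - 1)"
    using d by (intro one_less_power) auto
  with Suc_less show "0 < (2 ^ d - (real d + 1)) / ((2 ^ (d - 1) - 1) * (real d + 1))"
    by (intro divide_pos_pos mult_pos_pos) auto
next
  have "(\<lambda>d::nat. (2 ^ d - (real d + 1)) / ((2 ^ (d - 1) - 1) * (real d + 1))) \<longlonglongrightarrow> 0"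
    by real_asymp
  then show "(\<lambda>d. kendall_tau d (order_transform d (product_copula d))) \<longlonglongrightarrow> 0"
    by (rule Lim_transform_eventually)
      (auto simp: eventually_sequentially kendall_tau_order_transform_product_copula intro!: exI[of _ 2])
qed (simp_all add: copula_bracket_product_copula copula_bracket_order_transform_product_copula
    kendall_tau_product_copula kendall_tau_order_transform_product_copula)

end
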